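(* Let $\mathcal{C}$ be a clean tangled clutter of rank $r$. Then there exists a set $S\subseteq\{0,1\}^r$ such that the following statements hold: (i) $\mathrm{core}(\mathcal{C})$ is a duplication of $\mathrm{cuboid}(S)$, and up to isomorphism, $S$ is the unique set satisfying this property. (ii) There is a one-to-one correspondence between the fractional packings of value two in $\mathcal{C}$ and the different ways to express $\frac12\cdot\mathbf{1}$ as a convex combination of the points in $S$ (i.e. the vectors $\alpha\in\mathbb{R}^S_+$ with $\sum_{p\in S}\alpha_p=1$ and $\sum_{p\in S}\alpha_p\, p=\frac12\cdot\mathbf{1}$). (iii) $\mathrm{conv}(S)$ is a full-dimensional polytope (in $\mathbb{R}^r$) containing $\frac12\cdot\mathbf{1}$ in its interior.
   Context: Clutters. A clutter over a finite ground set $V$ is a family $\mathcal{C}$ of subsets of $V$ (its members), none of which contains another. A cover is a subset of $V$ that intersects every member; the blocker $b(\mathcal{C})$ is the clutter over $V$ of the inclusion-wise minimal covers. The covering number $\tau(\mathcal{C})$ is the minimum cardinality of a cover; a minimum cover is a cover of cardinality $\tau(\mathcal{C})$. For disjoint $I,J\subseteq V$, the minor $\mathcal{C}\setminus I/J$ (delete $I$, contract $J$) is the clutter over $V-(I\cup J)$ whose members are the inclusion-wise minimal sets in $\{C-J: C\in\mathcal{C},\ C\cap I=\emptyset\}$. Clutters are identified up to relabeling of the ground set. Clean, tangled. A delta is a clutter over a ground set $\{a_1,\dots,a_n\}$, $n\ge 3$, whose members are $\{a_2,\dots,a_n\}$ and $\{a_1,a_i\}$, $i=2,\dots,n$. An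 extended odd hole is a clutter over a ground set $\{a_1,\dots,a_n\}$, $n\ge5$ odd, whose minimum cardinality members are exactly $\{a_1,a_2\},\{a_2,a_3\},\dots,\{a_{n-1},a_n\},\{a_n,a_1\}$ (other members of cardinality at least three may exist). A clutter is clean if it has no minor that is a delta or the blocker of an extended odd hole. A clutter is tangled if its covering number is two and every element belongs to a minimum cover. Rank. For a clean tangled clutter $\mathcal{C}$ over $V$, $G(\mathcal{C})$ is the graph with vertex set $V$ whose edges are the minimum covers of $\mathcal{C}$. The rank of $\mathcal{C}$ is the number of connected components of $G(\mathcal{C})$. Fractional packings and core. A fractional packing of $\mathcal{C}$ is a vector $y\in\mathbb{R}^{\mathcal{C}}_+$ with $\sum(y_C: v\in C\in\mathcal{C})\le 1$ for all $v\in V$; its value is $\sum_C y_C$. For a clean tangled clutter, $\mathrm{core}(\mathcal{C})=\{C\in\mathcal{C}: y_C>0\text{ for some fractional packing }y\text{ of value two}\}$ (a clutter over $V$). Cuboids, duplication, isomorphism. For $S\subseteq\{0,1\}^n$, $\mathrm{cuboid}(S)$ is the clutter over $\{1,\dots,2n\}$ whose members have incidence vectors $(p_1,1-p_1,\dots,p_n,1-p_n)$, $p\in S$. To duplicate an element $w$ of a clutter is to add a new element $\bar w$ to the ground set and to add $\bar w$ to exactly those members that contain $w$. A duplication of a clutter is any clutter obtained from it by duplicating some elements (possibly none, possibly repeatedly). Twisting coordinate $i$ of $S$ means replacing $p_i$ by $1-p_i$ for all $p\in S$. Two sets $S_1,S_2\subseteq\{0,1\}^n$ are isomorphic if one is obtained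 from the other by relabeling (permuting) and twisting some coordinates. *)

theory Defs
  imports "HOL-Analysis.Analysis" "HOL-Library.FuncSet" "HOL-Library.Extended_Nat"
begin

text \<open>
  A clutter is given by its ground set \<open>V\<close> together with its family of members.
\<close>

definition clutter :: "'a set \<Rightarrow> 'a set set \<Rightarrow> bool" where
  "clutter V C \<longleftrightarrow> finite V \<and> C \<subseteq> Pow V \<and> (\<forall>A\<in>C. \<forall>B\<in>C. A \<subseteq> B \<longrightarrow> A = B)"

definition minimal_sets :: "'a set set \<Rightarrow> 'a set set" where
  "minimal_sets F = {A \<in> F. \<not> (\<exists>B\<in>F. B \<subset> A)}"

definition cover :: "'a set \<Rightarrow> 'a set set \<Rightarrow> 'a set \<Rightarrow> bool" where
  "cover V C B \<longleftrightarrow> B \<subseteq> V \<and> (\<forall>A\<in>C. B \<inter> A \<noteq> {})"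

definition blocker :: "'a set \<Rightarrow> 'a set set \<Rightarrow> 'a set set" where
  "blocker V C = minimal_sets {B. cover V C B}"

text \<open>
  The covering number is \<open>\<infinity>\<close> when there is no cover at all (i.e. when the empty set is a member).
\<close>

definition covering_number :: "'a set \<Rightarrow> 'a set set \<Rightarrow> enat" where
  "covering_number V C = (INF B\<in>{B. cover V C B}. enat (card B))"

definition minimum_covers :: "'a set \<Rightarrow> 'a set set \<Rightarrow> 'a set set" where
  "minimum_covers V C = {B. cover V C B \<and> enat (card B) = covering_number V C}"

text \<open>
  The members of the minor obtained by deleting \<open>I\<close> and contracting \<open>J\<close>;
  the ground set of this minor is \<open>V - (I \<union> J)\<close>.
\<close>

definition minor :: "'a set set \<Rightarrow> 'a set \<Rightarrow> 'a set \<Rightarrow> 'a set set" where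
  "minor C I J = minimal_sets {A - J | A. A \<in> C \<and> A \<inter> I = {}}"

definition delta :: "'a set \<Rightarrow> 'a set set \<Rightarrow> bool" where
  "delta V C \<longleftrightarrow> (\<exists>n\<ge>3. \<exists>a :: nat \<Rightarrow> 'a. bij_betw a {1..n} V \<and>
     C = insert (a ` {2..n}) {{a 1, a i} | i. i \<in> {2..n}})"

definition extended_odd_hole :: "'a set \<Rightarrow> 'a set set \<Rightarrow> bool" where
  "extended_odd_hole V C \<longleftrightarrow> clutter V C \<and>
     (\<exists>n\<ge>5. odd n \<and> (\<exists>a :: nat \<Rightarrow> 'a. bij_betw a {1..n} V \<and>
        {A \<in> C. \<forall>B\<in>C. card A \<le> card B}
          = insert {a n, a 1} {{a i, a (i + 1)} | i. i \<in> {1..<n}}))"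

definition clean :: "'a set \<Rightarrow> 'a set set \<Rightarrow> bool" where
  "clean V C \<longleftrightarrow> (\<forall>I J. I \<subseteq> V \<and> J \<subseteq> V \<and> I \<inter> J = {} \<longrightarrow>
     \<not> delta (V - (I \<union> J)) (minor C I J) \<and>
     \<not> (\<exists>D. extended_odd_hole (V - (I \<union> J)) D \<and> minor C I J = blocker (V - (I \<union> J)) D))"

definition tangled :: "'a set \<Rightarrow> 'a set set \<Rightarrow> bool" where
  "tangled V C \<longleftrightarrow> covering_number V C = 2 \<and> (\<forall>v\<in>V. \<exists>B\<in>minimum_covers V C. v \<in> B)"

definition connected_components_of_graph :: "'a set \<Rightarrow> 'a set set \<Rightarrow> 'a set set" where
  "connected_components_of_graph V E = V // {(u, v). {u, v} \<in> E}\<^sup>*"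

definition clutter_rank :: "'a set \<Rightarrow> 'a set set \<Rightarrow> nat" where
  "clutter_rank V C = card (connected_components_of_graph V (minimum_covers V C))"

text \<open>
  Vectors indexed by a set are extensional functions, so that equality of functions is
  equality of vectors.
\<close>

definition fractional_packing :: "'a set \<Rightarrow> 'a set set \<Rightarrow> ('a set \<Rightarrow> real) \<Rightarrow> bool" where
  "fractional_packing V C y \<longleftrightarrow> y \<in> C \<rightarrow>\<^sub>E {0..} \<and> (\<forall>v\<in>V. (\<Sum>A\<in>{A\<in>C. v \<in> A}. y A) \<le> 1)"

definition packings_of_value_two :: "'a set \<Rightarrow> 'a set set \<Rightarrow> ('a set \<Rightarrow> real) set" where
  "packings_of_value_two V C = {y. fractional_packing V C y \<and> (\<Sum>A\<in>C. y A) = 2}"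

definition core :: "'a set \<Rightarrow> 'a set set \<Rightarrow> 'a set set" where
  "core V C = {A \<in> C. \<exists>y \<in> packings_of_value_two V C. y A > 0}"

definition zero_one_points :: "(real ^ 'n) set" where
  "zero_one_points = {p. \<forall>i. p $ i = 0 \<or> p $ i = 1}"

text \<open>
  The ground set of the cuboid of \<open>S\<close> is the whole of \<open>'n \<times> bool\<close>: the pair \<open>(i, True)\<close> plays
  the role of the element \<open>2i - 1\<close>, with incidence \<open>p\<^sub>i\<close>, and \<open>(i, False)\<close> that of \<open>2i\<close>,
  with incidence \<open>1 - p\<^sub>i\<close>.
\<close>

definition cuboid_member :: "real ^ 'n \<Rightarrow> ('n \<times> bool) set" where
  "cuboid_member p = {(i, True) | i. p $ i = 1} \<union> {(i, False) | i. 1 - p $ i = 1}"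

definition cuboid :: "(real ^ 'n) set \<Rightarrow> ('n \<times> bool) set set" where
  "cuboid S = cuboid_member ` S"

definition duplicate :: "'a \<Rightarrow> 'a \<Rightarrow> 'a set set \<Rightarrow> 'a set set" where
  "duplicate w w' C = (\<lambda>A. if w \<in> A then insert w' A else A) ` C"

inductive duplicates_to :: "'a set \<Rightarrow> 'a set set \<Rightarrow> 'a set \<Rightarrow> 'a set set \<Rightarrow> bool"
  for W D where
  refl: "duplicates_to W D W D"
| step: "duplicates_to W D V C \<Longrightarrow> w \<in> V \<Longrightarrow> w' \<notin> V
         \<Longrightarrow> duplicates_to W D (insert w' V) (duplicate w w' C)"

text \<open>
  Clutters are identified up to relabeling of the ground set: \<open>C\<close> over \<open>V\<close> is a duplication of
  \<open>D\<close> over \<open>W\<close> if it arises by repeated duplication of elements from a relabeled copy of \<open>D\<close>.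
  No room is lost by taking the copy in the type of \<open>V\<close>, since its ground set is contained in \<open>V\<close>.
\<close>

definition duplication_of :: "'a set \<Rightarrow> 'a set set \<Rightarrow> 'b set \<Rightarrow> 'b set set \<Rightarrow> bool" where
  "duplication_of V C W D \<longleftrightarrow>
     (\<exists>g. inj_on g W \<and> duplicates_to (g ` W) ((`) g ` D) V C)"

definition relabel_coords :: "('n \<Rightarrow> 'n) \<Rightarrow> real ^ 'n \<Rightarrow> real ^ 'n" where
  "relabel_coords \<pi> p = (\<chi> i. p $ \<pi> i)"

definition twist_coords :: "'n set \<Rightarrow> real ^ 'n \<Rightarrow> real ^ 'n" where
  "twist_coords T p = (\<chi> i. if i \<in> T then 1 - p $ i else p $ i)"

definition isomorphic_sets :: "(real ^ 'n) set \<Rightarrow> (real ^ 'n) set \<Rightarrow> bool" where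
  "isomorphic_sets S1 S2 \<longleftrightarrow>
     (\<exists>\<pi> T. bij \<pi> \<and> S2 = twist_coords T ` relabel_coords \<pi> ` S1)"

definition convex_expressions :: "(real ^ 'n) set \<Rightarrow> real ^ 'n \<Rightarrow> (real ^ 'n \<Rightarrow> real) set" where
  "convex_expressions S x =
     {\<alpha> \<in> S \<rightarrow>\<^sub>E {0..}. (\<Sum>p\<in>S. \<alpha> p) = 1 \<and> (\<Sum>p\<in>S. \<alpha> p *\<^sub>R p) = x}"

end

theory Submission
  imports Defs
begin

text \<open>
  Let \<open>B\<close> be the blocker of \<open>C\<close>. Its members have at least two elements, those with exactly two
  are the minimum covers and form the graph, and cleanness says that \<open>B\<close> has neither a delta nor an
  extended odd hole minor. A shortest odd closed walk in the graph would give such a minor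
  (\<open>no_odd_closed_walk\<close>), so every component of the graph has a bipartition into two sides.

  In a fractional packing of value two both ends of an edge carry load one and every member of positive
  weight contains exactly one of them (\<open>packing_member_splits_pair\<close>). Such a member is a union of
  one side from each component, hence is given by a vertex \<open>p\<close> of the cube, and the core is a
  pullback of a cuboid along the map that sends an element to its component and side. Read in
  these coordinates, a packing of value two is twice a convex combination of the vertices with value
  the centre of the cube (\<open>packing_iff_convex_expression\<close>).

  Let \<open>S\<close> consist of all vertices whose union of sides is a member of \<open>C\<close>. What remains is that the
  centre is in the interior of the convex hull of \<open>S\<close>. It implies that every point of \<open>S\<close> has a
  positive coefficient in some expression of the centre, so that all of \<open>S\<close> belongs to the core, and it
  implies that no two labels are indistinguishable in \<open>S\<close>, which makes \<open>S\<close> unique up to isomorphism.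

  The interior condition means that each nonzero direction \<open>u\<close> has a point of \<open>S\<close> strictly below the
  centre. This is where cleanness enters. The central fact is that no member of \<open>B\<close> lies inside one
  side of a component (\<open>member_not_in_even_class\<close>). It follows that contracting one side of
  a component in \<open>B\<close> and deleting the other leaves a clutter whose members still have at least two
  elements (\<open>two_le_card_minor_of_sides\<close>). By choosing the heavier side for contraction
  and iterating, one finds for every nonnegative weight a cover of \<open>B\<close> with at most half
  of the total weight, and with less than half if the sides of some component differ in weight
  (\<open>less_half_weight_cover\<close>). For the weight that combines \<open>u\<close> with a large multiple
  of the degrees, this cover contains exactly one end of each edge (\<open>pair_splitting_cover\<close>), and so is
  a member of \<open>C\<close> that corresponds to the desired point of \<open>S\<close>.
\<close>

section \<open>Minors and blockers\<close>

lemma minimal_below: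
  assumes "A \<in> F" "finite A"
  obtains B where "B \<in> minimal_sets F" "B \<subseteq> A"
proof -
  have "\<exists>B\<in>minimal_sets F. B \<subseteq> A"
    using assms(2,1)
  proof (induction A rule: finite_psubset_induct)
    case (psubset A)
    show ?case
    proof (cases "\<exists>B\<in>F. B \<subset> A")
      case True
      then obtain B where "B \<in> F" "B \<subset> A" by blast
      then show ?thesis using psubset.IH[of B] by blast
    next
      case False
      then show ?thesis using psubset.prems by (auto simp: minimal_sets_def)
    qed
  qed
  then show ?thesis using that by blast
qed

text \<open>
  This lets covers and minors be compared through any family with the same minimal sets, without
  describing those minimal sets.
\<close>

lemma minimal_sets_cofinal:
  assumes "F \<subseteq> G" "\<And>A. A \<in> G \<Longrightarrow> \<exists>B\<in>F. B \<subseteq> A"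
  shows "minimal_sets F = minimal_sets G"
proof
  show "minimal_sets F \<subseteq> minimal_sets G"
  proof
    fix A assume A: "A \<in> minimal_sets F"
    have "\<not> B \<subset> A" if B: "B \<in> G" for B
    proof
      assume "B \<subset> A"
      moreover obtain B' where "B' \<in> F" "B' \<subseteq> B" using assms(2)[OF B] by blast
      ultimately show False using A unfolding minimal_sets_def by blast
    qed
    then show "A \<in> minimal_sets G" using A assms(1) unfolding minimal_sets_def by blast
  qed
  show "minimal_sets G \<subseteq> minimal_sets F"
  proof
    fix A assume A: "A \<in> minimal_sets G"
    then obtain B where B: "B \<in> F" "B \<subseteq> A"
      using assms(2)[of A] unfolding minimal_sets_def by blast
    with A assms(1) have "B = A" unfolding minimal_sets_def by blast
    with A B assms(1) show "A \<in> minimal_sets F" unfolding minimal_sets_def by blast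
  qed
qed

lemma clutter_finite_member: "clutter W B \<Longrightarrow> M \<in> B \<Longrightarrow> finite M"
  unfolding clutter_def by (meson PowD finite_subset subsetD)

lemma clutter_member_subset: "clutter W B \<Longrightarrow> M \<in> B \<Longrightarrow> M \<subseteq> W"
  unfolding clutter_def by blast

lemma clutter_member_eq: "clutter W B \<Longrightarrow> M \<in> B \<Longrightarrow> N \<in> B \<Longrightarrow> M \<subseteq> N \<Longrightarrow> M = N"
  unfolding clutter_def by blast

lemma minor_memberE:
  assumes "N \<in> minor B I J"
  obtains A where "A \<in> B" "A \<inter> I = {}" "N = A - J"
  using assms unfolding minor_def minimal_sets_def by blast

lemma minor_below:
  assumes "finite A" "A \<in> B" "A \<inter> I = {}"
  obtains N where "N \<in> minor B I J" "N \<subseteq> A - J"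
proof -
  have "A - J \<in> {A - J | A. A \<in> B \<and> A \<inter> I = {}}" using assms by blast
  from minimal_below[OF this] assms(1) that show ?thesis
    unfolding minor_def by blast
qed

lemma minor_memberI:
  assumes "A \<in> B" "A \<inter> I = {}" "\<And>A'. A' \<in> B \<Longrightarrow> A' \<inter> I = {} \<Longrightarrow> \<not> A' - J \<subset> A - J"
  shows "A - J \<in> minor B I J"
  using assms unfolding minor_def minimal_sets_def by blast

lemma clutter_minor:
  assumes "clutter W B"
  shows "clutter (W - (I \<union> J)) (minor B I J)"
proof -
  have "N \<subseteq> W - (I \<union> J)" if "N \<in> minor B I J" for N
  proof -
    from that obtain A where "A \<in> B" "A \<inter> I = {}" "N = A - J" by (rule minor_memberE)
    then show ?thesis using clutter_member_subset[OF assms] by blast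
  qed
  moreover have "M = N" if "M \<in> minor B I J" "N \<in> minor B I J" "M \<subseteq> N" for M N
    using that unfolding minor_def minimal_sets_def by blast
  ultimately show ?thesis using assms unfolding clutter_def by auto
qed

lemma minor_minor:
  assumes "clutter W B" "I' \<inter> J = {}"
  shows "minor (minor B I J) I' J' = minor B (I \<union> I') (J \<union> J')"
proof -
  have "{A - J' | A. A \<in> minor B I J \<and> A \<inter> I' = {}}
      \<subseteq> {A - (J \<union> J') | A. A \<in> B \<and> A \<inter> (I \<union> I') = {}}"
  proof
    fix X assume "X \<in> {A - J' | A. A \<in> minor B I J \<and> A \<inter> I' = {}}"
    then obtain A where A: "A \<in> minor B I J" "A \<inter> I' = {}" "X = A - J'" by blast
    from A(1) obtain D where D: "D \<in> B" "D \<inter> I = {}" "A = D - J" by (rule minor_memberE)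
    have "D \<inter> (I \<union> I') = {}" using A D assms(2) by blast
    moreover have "X = D - (J \<union> J')" using A D by blast
    ultimately show "X \<in> {A - (J \<union> J') | A. A \<in> B \<and> A \<inter> (I \<union> I') = {}}" using D by blast
  qed
  moreover have "\<exists>Y\<in>{A - J' | A. A \<in> minor B I J \<and> A \<inter> I' = {}}. Y \<subseteq> X"
    if X: "X \<in> {A - (J \<union> J') | A. A \<in> B \<and> A \<inter> (I \<union> I') = {}}" for X
  proof -
    from X obtain D where D: "D \<in> B" "D \<inter> (I \<union> I') = {}" "X = D - (J \<union> J')" by blast
    obtain N where N: "N \<in> minor B I J" "N \<subseteq> D - J"
      using minor_below[of D B I J] clutter_finite_member[OF assms(1) D(1)] D by blast
    have "N \<inter> I' = {}" "N - J' \<subseteq> X" using N D by blast+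
    with N show ?thesis by blast
  qed
  ultimately show ?thesis unfolding minor_def[of "minor B I J"] minor_def[of B "I \<union> I'"]
    by (rule minimal_sets_cofinal)
qed

lemma minor_delete:
  assumes "clutter W B"
  shows "minor B I {} = {M \<in> B. M \<inter> I = {}}"
proof -
  have "{A - {} | A. A \<in> B \<and> A \<inter> I = {}} = {M \<in> B. M \<inter> I = {}}" by auto
  moreover have "minimal_sets {M \<in> B. M \<inter> I = {}} = {M \<in> B. M \<inter> I = {}}"
    using clutter_member_eq[OF assms] unfolding minimal_sets_def by blast
  ultimately show ?thesis unfolding minor_def by argo
qed

lemma minor_empty: "clutter W B \<Longrightarrow> minor B {} {} = B"
  by (simp add: minor_delete)

lemma cover_above_blocker_member:
  assumes "finite V" "cover V C X"
  obtains M where "M \<in> blocker V C" "M \<subseteq> X"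
proof -
  have "finite X" using assms finite_subset unfolding cover_def by blast
  then show ?thesis
    using minimal_below[of X "{B. cover V C B}"] assms(2) that unfolding blocker_def by blast
qed

lemma blocker_member_cover: "M \<in> blocker V C \<Longrightarrow> cover V C M"
  unfolding blocker_def minimal_sets_def by blast

lemma clutter_blocker: "finite V \<Longrightarrow> clutter V (blocker V C)"
  using blocker_member_cover[of _ V C] unfolding clutter_def blocker_def minimal_sets_def
  by (metis (no_types, lifting) Pow_iff cover_def mem_Collect_eq psubsetI subsetI)

text \<open>
  Deletion and contraction trade places under the blocker: a set that meets every cover avoiding
  \<open>I\<close> contains a member together with \<open>I\<close>, because otherwise the complement of the union
  of the two would be such a cover. For \<open>I = J = {}\<close> this says that the blocker of the
  blocker is the clutter itself.
\<close>

lemma minor_eq_blocker_minor: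
  assumes C: "clutter V C" and IJ: "I \<inter> J = {}"
  shows "minor C J I = blocker (V - (I \<union> J)) (minor (blocker V C) I J)"
proof -
  let ?W = "V - (I \<union> J)" and ?B = "blocker V C"
  have fin: "finite V" using C unfolding clutter_def by blast
  have "{A - I | A. A \<in> C \<and> A \<inter> J = {}} \<subseteq> {X. cover ?W (minor ?B I J) X}"
  proof
    fix X assume "X \<in> {A - I | A. A \<in> C \<and> A \<inter> J = {}}"
    then obtain A where A: "A \<in> C" "A \<inter> J = {}" "X = A - I" by blast
    have "X \<inter> N \<noteq> {}" if N: "N \<in> minor ?B I J" for N
    proof -
      from N obtain M where M: "M \<in> ?B" "M \<inter> I = {}" "N = M - J" by (rule minor_memberE)
      have "M \<inter> A \<noteq> {}" using blocker_member_cover[OF M(1)] A unfolding cover_def by blast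
      then show ?thesis using A M by blast
    qed
    moreover have "X \<subseteq> ?W" using A clutter_member_subset[OF C A(1)] by blast
    ultimately show "X \<in> {X. cover ?W (minor ?B I J) X}" unfolding cover_def by blast
  qed
  moreover have "\<exists>Y\<in>{A - I | A. A \<in> C \<and> A \<inter> J = {}}. Y \<subseteq> X"
    if "X \<in> {X. cover ?W (minor ?B I J) X}" for X
  proof (rule ccontr)
    assume no: "\<not> (\<exists>Y\<in>{A - I | A. A \<in> C \<and> A \<inter> J = {}}. Y \<subseteq> X)"
    from that have X: "X \<subseteq> ?W" "\<And>N. N \<in> minor ?B I J \<Longrightarrow> X \<inter> N \<noteq> {}"
      unfolding cover_def by auto
    have "(V - (X \<union> I)) \<inter> A \<noteq> {}" if A: "A \<in> C" for A
    proof
      assume "(V - (X \<union> I)) \<inter> A = {}"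
      then have "A \<subseteq> X \<union> I" using clutter_member_subset[OF C A] by blast
      then have "A \<inter> J = {}" "A - I \<subseteq> X" using X(1) IJ by blast+
      then show False using no A by blast
    qed
    then have "cover V C (V - (X \<union> I))" unfolding cover_def by blast
    with fin obtain M where M: "M \<in> ?B" "M \<subseteq> V - (X \<union> I)"
      by (rule cover_above_blocker_member)
    then obtain N where "N \<in> minor ?B I J" "N \<subseteq> M - J"
      using minor_below[of M ?B I J] finite_subset[OF M(2)] fin by blast
    then show False using X(2) M by blast
  qed
  ultimately show ?thesis
    unfolding minor_def[of C] blocker_def[of ?W] by (rule minimal_sets_cofinal)
qed

lemma blocker_blocker:
  assumes "clutter V C"
  shows "blocker V (blocker V C) = C"
proof -
  have "finite V" using assms unfolding clutter_def by blast
  then have "minor (blocker V C) {} {} = blocker V C" by (rule minor_empty[OF clutter_blocker])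
  then show ?thesis
    using minor_eq_blocker_minor[OF assms, of "{}" "{}"] minor_empty[OF assms] by simp
qed

text \<open>
  In place of an enumeration of the ground set only its apex \<open>u\<close> and the large member \<open>L\<close> are named.
\<close>

lemma delta_altdef:
  "delta W D \<longleftrightarrow> (\<exists>u L. u \<notin> L \<and> finite L \<and> 2 \<le> card L \<and> W = insert u L \<and> D = insert L ((\<lambda>x. {u, x}) ` L))"
proof
  assume "delta W D"
  then obtain n and a :: "nat \<Rightarrow> 'a" where n: "n \<ge> 3" "bij_betw a {1..n} W"
    "D = insert (a ` {2..n}) {{a 1, a i} | i. i \<in> {2..n}}"
    unfolding delta_def by blast
  have s: "{1..n} = insert 1 {2..n}" using n(1) by auto
  have inj: "inj_on a {1..n}" using n(2) bij_betw_def by blast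
  have "a 1 \<notin> a ` {2..n}" using inj unfolding s inj_on_insert by simp
  moreover have "card (a ` {2..n}) = card {2..n}"
    using inj unfolding s inj_on_insert by (intro card_image) blast
  then have "2 \<le> card (a ` {2..n})" using n(1) by simp
  moreover have "W = insert (a 1) (a ` {2..n})" using n(2) unfolding s bij_betw_def by blast
  moreover have "D = insert (a ` {2..n}) ((\<lambda>x. {a 1, x}) ` a ` {2..n})" using n(3) by blast
  ultimately show "\<exists>u L. u \<notin> L \<and> finite L \<and> 2 \<le> card L \<and> W = insert u L \<and> D = insert L ((\<lambda>x. {u, x}) ` L)"
    by blast
next
  assume "\<exists>u L. u \<notin> L \<and> finite L \<and> 2 \<le> card L \<and> W = insert u L \<and> D = insert L ((\<lambda>x. {u, x}) ` L)"
  then obtain u L where L: "u \<notin> L" "finite L" "2 \<le> card L" "W = insert u L" "D = insert L ((\<lambda>x. {u, x}) ` L)"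
    by blast
  define n where "n = card L + 1"
  have "card {2..n} = card L" unfolding n_def by simp
  then obtain h where h: "bij_betw h {2..n} L"
    using L(2) finite_same_card_bij[of "{2..n}" L] by auto
  define a where "a = h(1 := u)"
  have im: "a ` {2..n} = L" using h unfolding a_def bij_betw_def by auto
  have s: "{1..n} = insert 1 {2..n}" using L(3) unfolding n_def by auto
  have a1: "a 1 = u" unfolding a_def by simp
  have "inj_on a {2..n}" using h unfolding a_def bij_betw_def inj_on_def by auto
  then have "inj_on a {1..n}" unfolding s inj_on_insert using im a1 L(1) by auto
  then have "bij_betw a {1..n} W" unfolding bij_betw_def s image_insert im a1 L(4) by simp
  moreover have "{{a 1, a i} | i. i \<in> {2..n}} = (\<lambda>x. {u, x}) ` a ` {2..n}" using a1 by blast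
  ultimately show "delta W D" unfolding delta_def using L im
    by (intro exI[of _ n] conjI exI[of _ a]) (auto simp: n_def)
qed

lemma blocker_delta:
  assumes "delta W D"
  shows "blocker W D = D"
proof -
  from assms obtain u L where L: "u \<notin> L" "finite L" "2 \<le> card L" "W = insert u L"
    "D = insert L ((\<lambda>x. {u, x}) ` L)" unfolding delta_altdef by blast
  have ne: "L \<noteq> {}" using L(3) by auto
  have "D \<subseteq> {X. cover W D X}"
  proof
    fix X assume "X \<in> D"
    then consider "X = L" | x where "x \<in> L" "X = {u, x}" using L(5) by auto
    then show "X \<in> {X. cover W D X}"
      by cases (use ne L(4,5) in \<open>auto simp: cover_def\<close>)
  qed
  moreover have "\<exists>Y\<in>D. Y \<subseteq> X" if "X \<in> {X. cover W D X}" for X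
  proof (cases "u \<in> X")
    case True
    from that obtain x where "x \<in> X" "x \<in> L" unfolding cover_def L(5) by blast
    then have "{u, x} \<in> D" "{u, x} \<subseteq> X" using True L(5) by auto
    then show ?thesis by blast
  next
    case False
    then have "L \<subseteq> X" using that unfolding cover_def L(5) by auto
    then show ?thesis using L(5) by blast
  qed
  ultimately have "blocker W D = minimal_sets D"
    unfolding blocker_def by (rule minimal_sets_cofinal[symmetric])
  moreover have "A = A'" if "A \<in> D" "A' \<in> D" "A \<subseteq> A'" for A A'
  proof -
    have "L \<noteq> {y}" for y using L(3) by auto
    with L(1) have "\<not> L \<subseteq> {u, y}" for y using ne by blast
    then show ?thesis using that L(1) unfolding L(5) by fastforce
  qed
  then have "minimal_sets D = D" unfolding minimal_sets_def by blast
  ultimately show ?thesis by simp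
qed

section \<open>Clutters without delta or extended odd hole minors\<close>

text \<open>
  The condition that cleanness of a clutter puts on its blocker: deltas are their own blockers, and
  blockers of extended odd holes turn into extended odd holes.
\<close>

definition delta_hole_free :: "'a set \<Rightarrow> 'a set set \<Rightarrow> bool" where
  "delta_hole_free W B \<longleftrightarrow> clutter W B \<and> (\<forall>I J. I \<subseteq> W \<and> J \<subseteq> W \<and> I \<inter> J = {} \<longrightarrow>
     \<not> delta (W - (I \<union> J)) (minor B I J) \<and> \<not> extended_odd_hole (W - (I \<union> J)) (minor B I J))"

lemma delta_hole_free_minor:
  assumes "delta_hole_free W B" "I \<subseteq> W" "J \<subseteq> W" "I \<inter> J = {}"
  shows "delta_hole_free (W - (I \<union> J)) (minor B I J)"
proof -
  have cl: "clutter W B" using assms(1) unfolding delta_hole_free_def by blast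
  have "\<not> delta (W - (I \<union> J) - (I' \<union> J')) (minor (minor B I J) I' J') \<and>
        \<not> extended_odd_hole (W - (I \<union> J) - (I' \<union> J')) (minor (minor B I J) I' J')"
    if "I' \<subseteq> W - (I \<union> J)" "J' \<subseteq> W - (I \<union> J)" "I' \<inter> J' = {}" for I' J'
  proof -
    have 1: "minor (minor B I J) I' J' = minor B (I \<union> I') (J \<union> J')"
      using minor_minor[OF cl] that(1) by blast
    have 2: "W - (I \<union> J) - (I' \<union> J') = W - ((I \<union> I') \<union> (J \<union> J'))" by blast
    have "I \<union> I' \<subseteq> W" "J \<union> J' \<subseteq> W" "(I \<union> I') \<inter> (J \<union> J') = {}" using assms that by blast+
    then show ?thesis unfolding 1 2 using assms(1) unfolding delta_hole_free_def by blast
  qed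
  then show ?thesis using clutter_minor[OF cl] unfolding delta_hole_free_def by blast
qed

lemma clean_imp_blocker_delta_hole_free:
  assumes C: "clutter V C" and "clean V C"
  shows "delta_hole_free V (blocker V C)"
proof -
  have "\<not> delta (V - (I \<union> J)) (minor (blocker V C) I J) \<and>
        \<not> extended_odd_hole (V - (I \<union> J)) (minor (blocker V C) I J)"
    if IJ: "I \<subseteq> V" "J \<subseteq> V" "I \<inter> J = {}" for I J
  proof -
    have eq: "minor C J I = blocker (V - (I \<union> J)) (minor (blocker V C) I J)"
      using minor_eq_blocker_minor[OF C IJ(3)] .
    have "J \<inter> I = {}" "J \<union> I = I \<union> J" using IJ(3) by blast+
    then have no: "\<not> delta (V - (I \<union> J)) (minor C J I)"
      "\<not> (\<exists>D. extended_odd_hole (V - (I \<union> J)) D \<and> minor C J I = blocker (V - (I \<union> J)) D)"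
      using assms(2) IJ(1,2) unfolding clean_def by metis+
    show ?thesis using no eq blocker_delta[of "V - (I \<union> J)"] by metis
  qed
  moreover have "finite V" using C unfolding clutter_def by blast
  ultimately show ?thesis using clutter_blocker unfolding delta_hole_free_def by blast
qed

section \<open>Parity of walks among the two-element members\<close>

definition pair_graph :: "'a set set \<Rightarrow> 'a rel" where
  "pair_graph B = {(x, y). {x, y} \<in> B}"

text \<open>
  When no closed walk has odd length, the next two sets are the sides of the bipartition of the component
  of \<open>v\<close>, the first being the side of \<open>v\<close>. If \<open>v\<close> is isolated they are \<open>{v}\<close> and \<open>{}\<close>.
\<close>

definition even_reach :: "'a set set \<Rightarrow> 'a \<Rightarrow> 'a set" where
  "even_reach B v = {x. \<exists>n. even n \<and> (v, x) \<in> pair_graph B ^^ n}"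

definition odd_reach :: "'a set set \<Rightarrow> 'a \<Rightarrow> 'a set" where
  "odd_reach B v = {x. \<exists>n. odd n \<and> (v, x) \<in> pair_graph B ^^ n}"

lemma pair_graph_sym: "(x, y) \<in> pair_graph B \<Longrightarrow> (y, x) \<in> pair_graph B"
  unfolding pair_graph_def by (simp add: insert_commute)

lemma walk_sym: "(x, y) \<in> pair_graph B ^^ n \<Longrightarrow> (y, x) \<in> pair_graph B ^^ n"
proof (induction n arbitrary: y)
  case 0
  then show ?case by simp
next
  case (Suc n)
  then obtain z where "(x, z) \<in> pair_graph B ^^ n" "(z, y) \<in> pair_graph B" by auto
  then show ?case using Suc.IH pair_graph_sym by (metis relpow_Suc_I2)
qed

lemma walk_trans:
  "(x, y) \<in> pair_graph B ^^ m \<Longrightarrow> (y, z) \<in> pair_graph B ^^ n \<Longrightarrow> (x, z) \<in> pair_graph B ^^ (m + n)"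
  unfolding relpow_add by (rule relcompI)

lemma walk_obtain:
  assumes "(a, b) \<in> pair_graph B ^^ n"
  obtains f where "f 0 = a" "f n = b"
    "\<And>i j. i \<le> j \<Longrightarrow> j \<le> n \<Longrightarrow> (f i, f j) \<in> pair_graph B ^^ (j - i)"
proof -
  obtain f where f: "f 0 = a" "f n = b" "\<And>i. i < n \<Longrightarrow> (f i, f (Suc i)) \<in> pair_graph B"
    using assms unfolding relpow_fun_conv by blast
  have "(f i, f j) \<in> pair_graph B ^^ (j - i)" if "i \<le> j" "j \<le> n" for i j
    unfolding relpow_fun_conv by (rule exI[of _ "\<lambda>l. f (i + l)"]) (use f(3) that in auto)
  with f that show thesis by blast
qed

lemma even_reachI: "even n \<Longrightarrow> (v, x) \<in> pair_graph B ^^ n \<Longrightarrow> x \<in> even_reach B v"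
  unfolding even_reach_def by (intro CollectI exI[of _ n] conjI)

lemma even_reachE:
  assumes "x \<in> even_reach B v"
  obtains n where "even n" "(v, x) \<in> pair_graph B ^^ n"
  using assms unfolding even_reach_def by (elim CollectE exE conjE)

lemma odd_reachI: "odd n \<Longrightarrow> (v, x) \<in> pair_graph B ^^ n \<Longrightarrow> x \<in> odd_reach B v"
  unfolding odd_reach_def by (intro CollectI exI[of _ n] conjI)

lemma odd_reachE:
  assumes "x \<in> odd_reach B v"
  obtains n where "odd n" "(v, x) \<in> pair_graph B ^^ n"
  using assms unfolding odd_reach_def by (elim CollectE exE conjE)

lemma even_reach_refl: "v \<in> even_reach B v"
  by (rule even_reachI[of 0]) simp_all

lemma even_reach_sym: "x \<in> even_reach B v \<Longrightarrow> v \<in> even_reach B x"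
  by (erule even_reachE) (rule even_reachI[OF _ walk_sym])

lemma odd_reach_sym: "x \<in> odd_reach B v \<Longrightarrow> v \<in> odd_reach B x"
  by (erule odd_reachE) (rule odd_reachI[OF _ walk_sym])

lemma even_even_reach:
  assumes "x \<in> even_reach B v" "y \<in> even_reach B x"
  shows "y \<in> even_reach B v"
proof -
  obtain m where m: "even m" "(v, x) \<in> pair_graph B ^^ m" using assms(1) by (rule even_reachE)
  obtain n where n: "even n" "(x, y) \<in> pair_graph B ^^ n" using assms(2) by (rule even_reachE)
  show ?thesis by (rule even_reachI[OF _ walk_trans[OF m(2) n(2)]]) (use m(1) n(1) in simp)
qed

lemma even_odd_reach:
  assumes "x \<in> even_reach B v" "y \<in> odd_reach B x"
  shows "y \<in> odd_reach B v"
proof -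
  obtain m where m: "even m" "(v, x) \<in> pair_graph B ^^ m" using assms(1) by (rule even_reachE)
  obtain n where n: "odd n" "(x, y) \<in> pair_graph B ^^ n" using assms(2) by (rule odd_reachE)
  show ?thesis by (rule odd_reachI[OF _ walk_trans[OF m(2) n(2)]]) (use m(1) n(1) in simp)
qed

lemma odd_even_reach:
  assumes "x \<in> odd_reach B v" "y \<in> even_reach B x"
  shows "y \<in> odd_reach B v"
proof -
  obtain m where m: "odd m" "(v, x) \<in> pair_graph B ^^ m" using assms(1) by (rule odd_reachE)
  obtain n where n: "even n" "(x, y) \<in> pair_graph B ^^ n" using assms(2) by (rule even_reachE)
  show ?thesis by (rule odd_reachI[OF _ walk_trans[OF m(2) n(2)]]) (use m(1) n(1) in simp)
qed

lemma odd_odd_reach: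
  assumes "x \<in> odd_reach B v" "y \<in> odd_reach B x"
  shows "y \<in> even_reach B v"
proof -
  obtain m where m: "odd m" "(v, x) \<in> pair_graph B ^^ m" using assms(1) by (rule odd_reachE)
  obtain n where n: "odd n" "(x, y) \<in> pair_graph B ^^ n" using assms(2) by (rule odd_reachE)
  show ?thesis by (rule even_reachI[OF _ walk_trans[OF m(2) n(2)]]) (use m(1) n(1) in simp)
qed

lemma edge_odd_reach: "{x, y} \<in> B \<Longrightarrow> y \<in> odd_reach B x"
  by (rule odd_reachI[of 1]) (simp_all add: pair_graph_def)

lemma reach_step:
  assumes "{x, y} \<in> B"
  shows "y \<in> even_reach B v \<longleftrightarrow> x \<in> odd_reach B v"
    and "y \<in> odd_reach B v \<longleftrightarrow> x \<in> even_reach B v"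
proof -
  have xy: "y \<in> odd_reach B x" "x \<in> odd_reach B y"
    by (rule edge_odd_reach[OF assms], rule odd_reach_sym, rule edge_odd_reach[OF assms])
  show "y \<in> even_reach B v \<longleftrightarrow> x \<in> odd_reach B v"
    by (rule iffI, erule even_odd_reach[OF _ xy(2)], erule odd_odd_reach[OF _ xy(1)])
  show "y \<in> odd_reach B v \<longleftrightarrow> x \<in> even_reach B v"
    by (rule iffI, erule odd_odd_reach[OF _ xy(2)], erule even_odd_reach[OF _ xy(1)])
qed

lemma reach_cong:
  assumes "x \<in> odd_reach B v"
  shows "even_reach B x = odd_reach B v" "odd_reach B x = even_reach B v"
proof -
  note xv = odd_reach_sym[OF assms]
  show "even_reach B x = odd_reach B v"
    by (intro equalityI subsetI, erule odd_even_reach[OF assms], erule odd_odd_reach[OF xv])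
  show "odd_reach B x = even_reach B v"
    by (intro equalityI subsetI, erule odd_odd_reach[OF assms], erule odd_even_reach[OF xv])
qed

lemma reach_subset:
  assumes "clutter W B" "v \<in> W"
  shows "even_reach B v \<subseteq> W" "odd_reach B v \<subseteq> W"
proof -
  have "x \<in> W" if "(v, x) \<in> pair_graph B ^^ n" for x n
    using that assms(2)
  proof (induction n arbitrary: x)
    case 0
    then show ?case by simp
  next
    case (Suc n)
    then obtain z where "(z, x) \<in> pair_graph B" by auto
    then show ?case using assms(1) unfolding pair_graph_def clutter_def by blast
  qed
  then show "even_reach B v \<subseteq> W" "odd_reach B v \<subseteq> W"
    unfolding even_reach_def odd_reach_def by blast+
qed

text \<open>
  A shortest closed walk of odd length visits its vertices once and has no chord, since a repeated
  vertex or a chord would split it into two closed walks of opposite parity, the odd one shorter. The members inside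
  its vertex set then form a delta on three elements or an extended odd hole.
\<close>

lemma no_odd_closed_walk:
  assumes free: "delta_hole_free W B" and two: "\<And>M. M \<in> B \<Longrightarrow> 2 \<le> card M" and "odd n"
  shows "(v, v) \<notin> pair_graph B ^^ n"
proof
  assume walk: "(v, v) \<in> pair_graph B ^^ n"
  have cl: "clutter W B" using free unfolding delta_hole_free_def by blast
  let ?P = "\<lambda>n. odd n \<and> (\<exists>v. (v, v) \<in> pair_graph B ^^ n)"
  define k where "k = (LEAST n. ?P n)"
  have k: "?P k" unfolding k_def by (rule LeastI[of ?P n]) (use walk \<open>odd n\<close> in blast)
  have least: "even l" if "(x, x) \<in> pair_graph B ^^ l" "l < k" for l x
    using that Least_le[of ?P l] unfolding k_def by fastforce
  from k obtain u where u: "odd k" "(u, u) \<in> pair_graph B ^^ k" by blast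
  from u(2) obtain f where f: "f 0 = u" "f k = u"
    "\<And>i j. i \<le> j \<Longrightarrow> j \<le> k \<Longrightarrow> (f i, f j) \<in> pair_graph B ^^ (j - i)"
    by (rule walk_obtain) blast
  have k0: "0 < k" using u(1) by (cases k) auto
  have around: "(f j, f i) \<in> pair_graph B ^^ (k - (j - i))" if "i \<le> j" "j \<le> k" for i j
    using walk_trans[OF f(3)[OF that(2) le_refl], of "f i" i] f(3)[of 0 i] f(1,2) that by simp
  \<comment> \<open>The walk closes up, so its vertices are enumerated by the indices from 1 to k.\<close>
  have inj: "f i \<noteq> f j" if ij: "1 \<le> i" "i < j" "j \<le> k" for i j
  proof
    assume eq: "f i = f j"
    have "(f i, f i) \<in> pair_graph B ^^ (j - i)" using f(3)[of i j] ij eq by simp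
    moreover have "j - i < k" "k - (j - i) < k" using ij by simp_all
    ultimately have "even (j - i)" using least by blast
    moreover have "(f i, f i) \<in> pair_graph B ^^ (k - (j - i))" using around[of i j] ij eq by simp
    then have "even (k - (j - i))" using \<open>k - (j - i) < k\<close> least by blast
    ultimately have "even ((j - i) + (k - (j - i)))" by simp
    then show False using u(1) ij by simp
  qed
  have chord: "j = Suc i \<or> (i = 1 \<and> j = k)"
    if ij: "1 \<le> i" "i < j" "j \<le> k" and e: "{f i, f j} \<in> B" for i j
  proof (rule ccontr)
    assume no: "\<not> (j = Suc i \<or> (i = 1 \<and> j = k))"
    have step: "(f j, f i) \<in> pair_graph B ^^ 1" "(f i, f j) \<in> pair_graph B ^^ 1"
      using e by (auto simp: pair_graph_def insert_commute)
    have "(f i, f i) \<in> pair_graph B ^^ (j - i + 1)"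
      using walk_trans[OF f(3)[of i j] step(1)] ij by simp
    moreover have short: "j - i + 1 < k" "k - (j - i) + 1 < k" using ij no by linarith+
    ultimately have "even (j - i + 1)" using least by blast
    moreover have "(f j, f j) \<in> pair_graph B ^^ (k - (j - i) + 1)"
      using walk_trans[OF around[of i j] step(2)] ij by simp
    then have "even (k - (j - i) + 1)" using short least by blast
    ultimately have "even ((j - i + 1) + (k - (j - i) + 1))" by (metis even_add)
    then show False using u(1) ij by simp
  qed
  have edge: "{f i, f (Suc i)} \<in> B" if "i < k" for i
    using f(3)[of i "Suc i"] that by (simp add: pair_graph_def)
  have closing: "{f k, f 1} \<in> B" using edge[OF k0] f(1,2) by simp
  have "k \<noteq> 1"
  proof
    assume "k = 1"
    then have "{f 1} \<in> B" using closing by simp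
    then show False using two by fastforce
  qed
  then have k3: "3 \<le> k" using u(1) k0 by (cases "k = 2") auto
  define X where "X = f ` {1..k}"
  have bij: "bij_betw f {1..k} X"
    unfolding X_def bij_betw_def inj_on_def using inj by (metis atLeastAtMost_iff linorder_neqE_nat)
  have XW: "X \<subseteq> W"
  proof
    fix x assume "x \<in> X"
    then obtain i where "1 \<le> i" "i \<le> k" "x = f i" unfolding X_def by auto
    then have "{f (i - 1), x} \<in> B" using edge[of "i - 1"] by simp
    then show "x \<in> W" using clutter_member_subset[OF cl] by blast
  qed
  have ground: "W - ((W - X) \<union> {}) = X" using XW by blast
  define D where "D = {M \<in> B. M \<subseteq> X}"
  have res: "minor B (W - X) {} = D"
    unfolding minor_delete[OF cl] D_def using clutter_member_subset[OF cl] by blast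
  have notD: "\<not> delta X D" "\<not> extended_odd_hole X D"
    using free[unfolded delta_hole_free_def, THEN conjunct2, rule_format, of "W - X" "{}"]
    unfolding ground res by auto
  let ?E = "insert {f k, f 1} {{f i, f (i + 1)} | i. i \<in> {1..<k}}"
  have ED: "?E \<subseteq> D"
  proof
    fix e assume "e \<in> ?E"
    then show "e \<in> D" using edge closing k3 unfolding D_def X_def by auto
  qed
  have DE: "M \<in> ?E" if M: "M \<in> D" "{x, y} \<subseteq> M" "x \<noteq> y" "{x, y} \<in> B" for M x y
  proof -
    have eq: "M = {x, y}" using clutter_member_eq[OF cl M(4) _ M(2)] M(1) unfolding D_def by blast
    then obtain i j where ij: "x = f i" "y = f j" "1 \<le> i" "i \<le> k" "1 \<le> j" "j \<le> k"
      using M(1) unfolding D_def X_def by auto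
    consider "i < j" | "j < i" using ij M(3) by (metis linorder_neqE_nat)
    then show ?thesis
    proof cases
      case 1
      then show ?thesis using chord[of i j] ij M(4) eq by (auto simp: insert_commute)
    next
      case 2
      then have "i = Suc j \<or> (j = 1 \<and> i = k)"
        using chord[of j i] ij M(4) by (simp add: insert_commute)
      then show ?thesis using 2 ij eq by (auto simp: insert_commute)
    qed
  qed
  show False
  proof (cases "k = 3")
    case True
    have "{1..k} = {1,2,3}" using True by auto
    then have X3: "X = {f 1, f 2, f 3}" unfolding X_def by simp
    have d3: "f 1 \<noteq> f 2" "f 1 \<noteq> f 3" "f 2 \<noteq> f 3" using inj[of 1 2] inj[of 1 3] inj[of 2 3] True by auto
    have e3: "{f 1, f 2} \<in> B" "{f 2, f 3} \<in> B" "{f 1, f 3} \<in> B"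
      using edge[of 1] edge[of 2] closing True by (auto simp: insert_commute numeral_2_eq_2 numeral_3_eq_3)
    have "M \<in> {{f 2, f 3}, {f 1, f 2}, {f 1, f 3}}" if "M \<in> D" for M
    proof -
      have "M \<subseteq> {f 1, f 2, f 3}" "M \<in> B" using that X3 unfolding D_def by auto
      moreover have "\<not> M \<subseteq> {z}" for z
        using two[OF \<open>M \<in> B\<close>] card_mono[of "{z}" M] by auto
      ultimately have "{f 1, f 2} \<subseteq> M \<or> {f 2, f 3} \<subseteq> M \<or> {f 1, f 3} \<subseteq> M" by blast
      then show ?thesis using clutter_member_eq[OF cl _ \<open>M \<in> B\<close>] e3 by blast
    qed
    then have "D = {{f 2, f 3}, {f 1, f 2}, {f 1, f 3}}" using e3 X3 unfolding D_def by auto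
    then have "D = insert {f 2, f 3} ((\<lambda>x. {f 1, x}) ` {f 2, f 3})" by auto
    then have "delta X D" unfolding delta_altdef
      using d3 X3 by (intro exI[of _ "f 1"] exI[of _ "{f 2, f 3}"]) auto
    then show False using notD by blast
  next
    case False
    then have k5: "5 \<le> k" using k3 u(1) by (cases "k = 4") auto
    have pair: "{f k, f 1} \<in> D" "card {f k, f 1} = 2"
      using ED inj[of 1 k] k3 by (auto simp: card_insert_if)
    have "{A \<in> D. \<forall>M\<in>D. card A \<le> card M} = {A \<in> D. card A = 2}"
    proof -
      have "2 \<le> card M" if "M \<in> D" for M using that two unfolding D_def by blast
      then show ?thesis using pair by force
    qed
    also have "\<dots> = ?E"
    proof (intro equalityI subsetI)
      fix A assume A: "A \<in> {A \<in> D. card A = 2}"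
      then obtain x y where "A = {x, y}" "x \<noteq> y" by (auto simp: card_2_iff)
      then show "A \<in> ?E" using DE[of A x y] A unfolding D_def by auto
    next
      fix A assume A: "A \<in> ?E"
      then obtain i j where "A = {f i, f j}" "1 \<le> i" "i < j" "j \<le> k" using k3 by force
      then have "card A = 2" using inj by auto
      then show "A \<in> {A \<in> D. card A = 2}" using A ED by blast
    qed
    finally have "{A \<in> D. \<forall>M\<in>D. card A \<le> card M} = ?E" .
    moreover have "clutter X D" using clutter_minor[OF cl, of "W - X" "{}"] unfolding ground res .
    ultimately have "extended_odd_hole X D"
      unfolding extended_odd_hole_def using k5 u(1) bij by blast
    then show False using notD by blast
  qed
qed

section \<open>No member joins vertices of one colour\<close>

lemma exists_maximal_subset:
  assumes "finite X" "P {}"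
  obtains J where "J \<subseteq> X" "P J" "\<And>x. x \<in> X - J \<Longrightarrow> \<not> P (insert x J)"
proof -
  let ?F = "{J. J \<subseteq> X \<and> P J}"
  have "finite ?F" using assms(1) by simp
  moreover have "?F \<noteq> {}" using assms(2) by blast
  ultimately obtain J where J: "J \<in> ?F" "\<forall>K\<in>?F. J \<subseteq> K \<longrightarrow> J = K"
    using finite_has_maximal[of ?F] by meson
  have "\<not> P (insert x J)" if "x \<in> X - J" for x
    using J(2)[rule_format, of "insert x J"] J(1) that by blast
  then show thesis using that J(1) by blast
qed

text \<open>
  Contract a set \<open>J \<subseteq> L - {a, b}\<close> that is maximal subject to \<open>insert u J\<close> containing no member.
  By maximality \<open>u\<close> is then joined to every remaining element of \<open>L\<close>, which is a delta.
\<close>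

lemma delta_minor_of_common_neighbour:
  assumes cl: "clutter W B" and L: "L \<in> B" "u \<notin> L" "a \<in> L" "b \<in> L" "a \<noteq> b"
    and e: "{u, a} \<in> B" "{u, b} \<in> B"
  obtains I J where "I \<subseteq> W" "J \<subseteq> W" "I \<inter> J = {}" "delta (W - (I \<union> J)) (minor B I J)"
proof -
  have fL: "finite L" and LW: "L \<subseteq> W" and uW: "u \<in> W"
    using clutter_finite_member[OF cl] clutter_member_subset[OF cl] L(1) e by blast+
  have sub: "M = N" if "M \<in> B" "N \<in> B" "M \<subseteq> N" for M N
    using clutter_member_eq[OF cl that] .
  let ?P = "\<lambda>J. \<forall>M\<in>B. \<not> M \<subseteq> insert u J"
  have "?P {}"
  proof (intro ballI notI)
    fix M assume "M \<in> B" "M \<subseteq> {u}"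
    then have "M = {u, a}" using sub[OF _ e(1)] by blast
    then show False using \<open>M \<subseteq> {u}\<close> L(2,3) by blast
  qed
  with fL obtain J where J: "J \<subseteq> L - {a, b}" "?P J" "\<And>x. x \<in> L - {a, b} - J \<Longrightarrow> \<not> ?P (insert x J)"
    using exists_maximal_subset[of "L - {a, b}" ?P] by (metis finite_Diff)
  define L' where "L' = L - J"
  have L': "a \<in> L'" "b \<in> L'" "u \<notin> L'" using L J(1) unfolding L'_def by blast+
  let ?I = "W - insert u L"
  have inI: "A \<inter> ?I = {} \<longleftrightarrow> A \<subseteq> insert u L" if "A \<in> B" for A
    using clutter_member_subset[OF cl that] by blast
  have 1: "L' \<in> minor B ?I J"
    unfolding L'_def
  proof (rule minor_memberI)
    fix A' assume A': "A' \<in> B" "A' \<inter> ?I = {}"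
    show "\<not> A' - J \<subset> L - J"
    proof
      assume *: "A' - J \<subset> L - J"
      then have "A' \<subseteq> L" using J(1) by blast
      then show False using sub[OF A'(1) L(1)] * by blast
    qed
  qed (use L in blast)+
  have 2: "{u, x} \<in> minor B ?I J" if x: "x \<in> L'" for x
  proof -
    obtain M where M: "M \<in> B" "M \<subseteq> insert u (insert x J)"
    proof (cases "x \<in> {a, b}")
      case True
      then show ?thesis using that e by blast
    next
      case False
      then show ?thesis using that J(3)[of x] x unfolding L'_def by blast
    qed
    have xM: "x \<in> M" using M J(2) by blast
    have proper: "\<not> N \<subseteq> insert x J" if "N \<in> B" for N
    proof
      assume *: "N \<subseteq> insert x J"
      then have "N = L" using sub[OF that L(1)] J(1) x unfolding L'_def by blast
      then show False using * L J(1) by blast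
    qed
    have uM: "u \<in> M" using M proper by blast
    have eq: "{u, x} = M - J" using M(2) xM uM x J(1) L(2) unfolding L'_def by blast
    show ?thesis
      unfolding eq
    proof (rule minor_memberI)
      show "M \<in> B" by fact
      show "M \<inter> ?I = {}" using inI[OF M(1)] M(2) x J(1) unfolding L'_def by blast
      fix A' assume A': "A' \<in> B" "A' \<inter> ?I = {}"
      have "\<not> A' \<subseteq> insert u J" "\<not> A' \<subseteq> insert x J" using J(2) proper A'(1) by blast+
      then have "u \<in> A' - J" "x \<in> A' - J" if "A' - J \<subseteq> {u, x}" using that by blast+
      then show "\<not> A' - J \<subset> M - J" unfolding eq[symmetric] by blast
    qed
  qed
  have 3: "N = L' \<or> (\<exists>x\<in>L'. N = {u, x})" if N: "N \<in> minor B ?I J" for N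
  proof -
    obtain A where A: "A \<in> B" "A \<inter> ?I = {}" "N = A - J" using N by (rule minor_memberE)
    have AL: "A \<subseteq> insert u L" using inI[OF A(1)] A(2) by blast
    have anti: "N = N'" if "N' \<in> minor B ?I J" "N' \<subseteq> N" for N'
      using clutter_member_eq[OF clutter_minor[OF cl] that(1) N that(2)] by simp
    show ?thesis
    proof (cases "u \<in> A")
      case True
      obtain x where "x \<in> A" "x \<notin> insert u J" using J(2) A(1) by blast
      then have x: "x \<in> L'" "{u, x} \<subseteq> N" using AL A(3) True J(1) L(2) unfolding L'_def by blast+
      then show ?thesis using anti[OF 2[OF x(1)]] by blast
    next
      case False
      then have "A = L" using sub[OF A(1) L(1)] AL by blast
      then show ?thesis using A(3) L'_def by blast
    qed
  qed
  have D: "minor B ?I J = insert L' ((\<lambda>x. {u, x}) ` L')" using 1 2 3 by blast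
  have G: "W - (?I \<union> J) = insert u L'" using LW uW J(1) L(2) unfolding L'_def by blast
  have fL': "finite L'" using fL unfolding L'_def by simp
  have "2 \<le> card L'"
    using card_mono[OF fL', of "{a, b}"] L' L(5) by simp
  then have "delta (W - (?I \<union> J)) (minor B ?I J)"
    unfolding delta_altdef D G using L'(3) fL' by blast
  moreover have "?I \<subseteq> W" "J \<subseteq> W" "?I \<inter> J = {}" using J(1) LW by blast+
  ultimately show thesis using that by blast
qed

lemma pair_in_minor:
  assumes cl: "clutter W B" and "M \<in> B" "M \<inter> I = {}" "M - J \<subseteq> {x, y}"
    and two: "\<And>N. N \<in> minor B I J \<Longrightarrow> 2 \<le> card N"
  shows "{x, y} \<in> minor B I J"
proof -
  obtain N where N: "N \<in> minor B I J" "N \<subseteq> M - J"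
    using minor_below[of M B I J] clutter_finite_member[OF cl assms(2)] assms(2,3) by blast
  have "N = {x, y}"
  proof (rule card_seteq)
    show "N \<subseteq> {x, y}" using N assms(4) by blast
    show "card {x, y} \<le> card N" using two[OF N(1)] by (cases "x = y") auto
  qed simp
  then show ?thesis using N(1) by simp
qed

lemma even_odd_reach_disjoint:
  assumes "delta_hole_free W B" "\<And>M. M \<in> B \<Longrightarrow> 2 \<le> card M" "x \<in> even_reach B v"
  shows "x \<notin> odd_reach B v"
proof
  assume "x \<in> odd_reach B v"
  then have "v \<in> odd_reach B v" using odd_even_reach even_reach_sym[OF assms(3)] by metis
  then obtain n where "odd n" "(v, v) \<in> pair_graph B ^^ n" by (rule odd_reachE)
  then show False using no_odd_closed_walk[OF assms(1,2)] by metis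
qed

lemma two_le_card: "finite N \<Longrightarrow> x \<in> N \<Longrightarrow> y \<in> N \<Longrightarrow> x \<noteq> y \<Longrightarrow> 2 \<le> card N"
  using card_mono[of N "{x, y}"] by simp

text \<open>
  Induction on the size of \<open>L\<close>. Let \<open>a\<close>, \<open>b\<close> be distinct elements of \<open>L\<close> at the least even distance
  \<open>d\<close>, and \<open>P\<close> a walk of length \<open>d\<close> between them; its inner vertices avoid \<open>L\<close>. Delete everything
  outside \<open>P \<union> L\<close> and contract a set \<open>J \<subseteq> L - {a, b}\<close> that is maximal subject to every member inside
  \<open>J \<union> P\<close> having at least two elements in \<open>P\<close>; this bound keeps all members of the minor at two
  elements or more. By maximality each \<open>x \<in> L - J\<close> other than \<open>a\<close>, \<open>b\<close> becomes adjacent to an inner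
  vertex \<open>p\<close> of \<open>P\<close>. An even distance of \<open>p\<close> from \<open>a\<close> is excluded by induction, because the member
  that causes the adjacency would be smaller than \<open>L\<close> and in one even class. Hence it is odd, and
  \<open>L - J\<close> is again in one even class of the minor: the induction applies unless \<open>J = {}\<close>.
  If \<open>J = {}\<close> and \<open>L = {a, b}\<close>, then \<open>P\<close> and \<open>L\<close> form an odd closed walk. Otherwise some \<open>x\<close> is so
  close to \<open>a\<close> and \<open>b\<close> that the choice of the pair forces \<open>d = 2\<close>, and then \<open>a\<close> and \<open>b\<close> have a
  common neighbour.
\<close>

lemma member_not_in_even_class:
  assumes "delta_hole_free W B" "\<And>M. M \<in> B \<Longrightarrow> 2 \<le> card M" "L \<in> B"
    and "\<And>x y. x \<in> L \<Longrightarrow> y \<in> L \<Longrightarrow> y \<in> even_reach B x"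
  shows False
  using assms
proof (induction "card L" arbitrary: W B L rule: less_induct)
  case less
  note free = less.prems(1) and two = less.prems(2) and L = less.prems(3) and ev = less.prems(4)
  have cl: "clutter W B" using free unfolding delta_hole_free_def by blast
  have fL: "finite L" and LW: "L \<subseteq> W"
    using clutter_finite_member[OF cl L] clutter_member_subset[OF cl L] .
  have sub: "M = N" if "M \<in> B" "N \<in> B" "M \<subseteq> N" for M N
    using clutter_member_eq[OF cl that] .
  have parity: "x \<notin> odd_reach B v" if "x \<in> even_reach B v" for x v
    using even_odd_reach_disjoint[OF free two that] .
  let ?Q = "\<lambda>d. even d \<and> (\<exists>a\<in>L. \<exists>b\<in>L. a \<noteq> b \<and> (a, b) \<in> pair_graph B ^^ d)"
  have "\<not> L \<subseteq> {z}" for z using two[OF L] card_mono[of "{z}" L] by auto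
  then obtain a0 b0 where ab0: "a0 \<in> L" "b0 \<in> L" "a0 \<noteq> b0" by blast
  from ev[OF ab0(1,2)] obtain n0 where "even n0" "(a0, b0) \<in> pair_graph B ^^ n0"
    by (rule even_reachE)
  then have Q0: "?Q n0" using ab0 by meson
  define d where "d = (LEAST d. ?Q d)"
  have "?Q d" unfolding d_def by (rule LeastI[of ?Q, OF Q0])
  then obtain a b where ab: "even d" "a \<in> L" "b \<in> L" "a \<noteq> b" "(a, b) \<in> pair_graph B ^^ d" by meson
  have least: "d \<le> l" if "even l" "x \<in> L" "y \<in> L" "x \<noteq> y" "(x, y) \<in> pair_graph B ^^ l" for l x y
    unfolding d_def by (rule Least_le[of ?Q]) (use that in meson)
  obtain f where f: "f 0 = a" "f d = b"
    "\<And>i j. i \<le> j \<Longrightarrow> j \<le> d \<Longrightarrow> (f i, f j) \<in> pair_graph B ^^ (j - i)"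
    using ab(5) by (rule walk_obtain) blast
  have fa: "(a, f i) \<in> pair_graph B ^^ i" if "i \<le> d" for i using f(3)[of 0 i] f(1) that by simp
  have fb: "(f i, b) \<in> pair_graph B ^^ (d - i)" if "i \<le> d" for i using f(3)[of i d] f(2) that by simp
  have inner: "f i \<notin> L" if i: "0 < i" "i < d" for i
  proof
    assume fi: "f i \<in> L"
    have "even i"
    proof (rule ccontr)
      assume "odd i"
      then have "f i \<in> odd_reach B a" using odd_reachI[OF _ fa] i by simp
      then show False using parity[OF ev[OF ab(2) fi]] by blast
    qed
    then show False
      using least[OF _ ab(2) fi _ fa] least[OF _ fi ab(3) _ fb] ab(1,4) i by fastforce
  qed
  define P where "P = f ` {0..d}"
  have fP: "finite P" unfolding P_def by simp
  have aP: "a \<in> P" "b \<in> P" unfolding P_def using f(1,2) by force+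
  have PL: "P \<inter> L \<subseteq> {a, b}"
  proof
    fix p assume p: "p \<in> P \<inter> L"
    then obtain i where "p = f i" "i \<le> d" unfolding P_def by auto
    then show "p \<in> {a, b}" using inner[of i] p f(1,2) by (cases "i = 0"; cases "i = d") auto
  qed
  let ?R = "\<lambda>J. \<forall>M\<in>B. M \<subseteq> J \<union> P \<longrightarrow> 2 \<le> card (M \<inter> P)"
  have "?R {}" using two by (simp add: Int_absorb2)
  then obtain J where J: "J \<subseteq> L - {a, b}" "?R J" "\<And>x. x \<in> L - {a, b} - J \<Longrightarrow> \<not> ?R (insert x J)"
    using exists_maximal_subset[of "L - {a, b}" ?R] fL by (metis finite_Diff)
  define L' where "L' = L - J"
  define I where "I = W - (P \<union> L)"
  let ?B = "minor B I J"
  have L': "a \<in> L'" "b \<in> L'" "L' \<subseteq> L" using ab J(1) unfolding L'_def by blast+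
  have JP: "J \<inter> P = {}" using J(1) PL by blast
  have inI: "A \<inter> I = {} \<longleftrightarrow> A \<subseteq> P \<union> L" if "A \<in> B" for A
    using clutter_member_subset[OF cl that] unfolding I_def by blast
  have two': "2 \<le> card N" if N: "N \<in> ?B" for N
  proof -
    obtain A where A: "A \<in> B" "A \<inter> I = {}" "N = A - J" using N by (rule minor_memberE)
    have fA: "finite A" using clutter_finite_member[OF cl A(1)] .
    show ?thesis
    proof (cases "A \<subseteq> J \<union> P")
      case True
      then have "2 \<le> card (A \<inter> P)" using J(2) A(1) by blast
      also have "\<dots> \<le> card N" using fA JP unfolding A(3) by (intro card_mono) auto
      finally show ?thesis .
    next
      case False
      then obtain x where x: "x \<in> A" "x \<notin> J" "x \<notin> P" by blast
      then have xL: "x \<in> L" using A inI by blast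
      have "\<not> A \<subseteq> insert x J"
      proof
        assume *: "A \<subseteq> insert x J"
        then have "A = L" using sub[OF A(1) L] xL J(1) by blast
        then show False using * ab(2) aP(1) x(3) J(1) by blast
      qed
      then obtain y where "y \<in> A" "y \<noteq> x" "y \<notin> J" by blast
      then show ?thesis using two_le_card[of N x y] fA x A(3) by simp
    qed
  qed
  have edge': "(f i, f (Suc i)) \<in> pair_graph ?B" if "i < d" for i
  proof -
    have e: "{f i, f (Suc i)} \<in> B" using f(3)[of i "Suc i"] that by (simp add: pair_graph_def)
    have "{f i, f (Suc i)} \<subseteq> P" using that unfolding P_def by simp
    then have "{f i, f (Suc i)} \<in> ?B"
      using pair_in_minor[OF cl e _ _ two'] inI[OF e] by blast
    then show ?thesis unfolding pair_graph_def by simp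
  qed
  have fa': "(a, f i) \<in> pair_graph ?B ^^ i" if "i \<le> d" for i
    using that
  proof (induction i)
    case 0
    then show ?case using f(1) by simp
  next
    case (Suc i)
    then show ?case using edge'[of i] by (metis Suc_le_lessD less_imp_le relpow_Suc_I)
  qed
  have attach: "\<exists>i. 0 < i \<and> i < d \<and> odd i \<and> {f i, x} \<in> ?B" if x: "x \<in> L' - {a, b}" for x
  proof -
    have xJ: "x \<in> L - {a, b} - J" using x unfolding L'_def by blast
    then obtain M where M: "M \<in> B" "M \<subseteq> insert x J \<union> P" "card (M \<inter> P) < 2"
      using J(3)[OF xJ] by (meson not_le)
    have "M \<inter> P \<noteq> {}"
    proof
      assume "M \<inter> P = {}"
      then have "M \<subseteq> L" using M(2) xJ J(1) by blast
      then have "M = L" using sub[OF M(1) L] by blast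
      then show False using \<open>M \<inter> P = {}\<close> aP ab by blast
    qed
    then have "card (M \<inter> P) = 1" using M(3) fP by (simp add: card_gt_0_iff less_2_cases_iff)
    then obtain p where p: "M \<inter> P = {p}" by (rule card_1_singletonE)
    have MM: "M \<subseteq> insert p (insert x J)" using M(2) equalityD1[OF p] by blast
    have pL: "p \<notin> L"
    proof
      assume "p \<in> L"
      then have "M \<subseteq> L" using MM xJ J(1) by blast
      then have "M = L" using sub[OF M(1) L] by blast
      then have "a \<in> M \<inter> P" "b \<in> M \<inter> P" using aP ab by blast+
      then show False using ab(4) unfolding p by simp
    qed
    have "p \<in> P" using p by blast
    then obtain i where i: "p = f i" "i \<le> d" unfolding P_def by auto
    have "i \<noteq> 0" "i \<noteq> d" using pL i(1) f(1,2) ab(2,3) by metis+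
    then have i': "0 < i" "i < d" using i(2) by simp_all
    have "odd i"
    proof
      assume "even i"
      then have "p \<in> even_reach B a" using even_reachI[OF _ fa] i by simp
      then have "y \<in> even_reach B a" if "y \<in> M" for y
        using that MM ev[OF ab(2)] xJ J(1) by blast
      then have "y \<in> even_reach B z" if "z \<in> M" "y \<in> M" for z y
        using that even_even_reach even_reach_sym by metis
      moreover have "card M < card L"
      proof -
        have "card M \<le> card (insert p (L - {a, b}))"
          using MM xJ J(1) fL by (intro card_mono) auto
        also have "\<dots> \<le> Suc (card (L - {a, b}))" using fL by (simp add: card_insert_if)
        also have "card (L - {a, b}) = card L - 2"
          using ab fL by (subst card_Diff_subset) auto
        finally have "card M \<le> Suc (card L - 2)" .
        then show ?thesis using two_le_card[OF fL ab(2,3,4)] two[OF M(1)] by linarith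
      qed
      ultimately show False using less.hyps[OF _ free two M(1)] by blast
    qed
    moreover have "{p, x} \<in> ?B"
      using pair_in_minor[OF cl M(1) _ _ two'] inI[OF M(1)] MM M(2) xJ J(1) by blast
    ultimately show ?thesis using i i' by blast
  qed
  have ev': "x \<in> even_reach ?B a" if x: "x \<in> L'" for x
  proof -
    consider "x = a" | "x = b" | "x \<in> L' - {a, b}" using x by blast
    then show ?thesis
    proof cases
      case 1
      then show ?thesis by (simp add: even_reach_refl)
    next
      case 2
      then show ?thesis using even_reachI[OF ab(1) fa'] f(2) by simp
    next
      case 3
      then obtain i where i: "i < d" "odd i" "{f i, x} \<in> ?B" using attach by blast
      have "f i \<in> odd_reach ?B a" using odd_reachI[OF i(2) fa'] i(1) by simp
      then show ?thesis using reach_step(1)[OF i(3)] by blast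
    qed
  qed
  show False
  proof (cases "J = {}")
    case False
    have "I \<subseteq> W" "J \<subseteq> W" "I \<inter> J = {}" using J(1) LW unfolding I_def by blast+
    then have "delta_hole_free (W - (I \<union> J)) ?B" by (rule delta_hole_free_minor[OF free])
    moreover have "L' \<in> ?B"
      unfolding L'_def
    proof (rule minor_memberI)
      show "L \<inter> I = {}" unfolding I_def by blast
      fix A' assume A': "A' \<in> B" "A' \<inter> I = {}"
      show "\<not> A' - J \<subset> L - J"
      proof
        assume *: "A' - J \<subset> L - J"
        then have "A' \<subseteq> L" using J(1) by blast
        then show False using sub[OF A'(1) L] * by blast
      qed
    qed (rule L)
    moreover have "card L' < card L"
      using False J(1) fL unfolding L'_def by (intro psubset_card_mono) auto
    moreover have "y \<in> even_reach ?B x" if "x \<in> L'" "y \<in> L'" for x y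
      using even_even_reach[OF even_reach_sym[OF ev'[OF that(1)]] ev'[OF that(2)]] .
    ultimately show False using less.hyps two' by blast
  next
    case True
    show False
    proof (cases "L = {a, b}")
      case True
      then have "b \<in> odd_reach B a" using edge_odd_reach L by metis
      then show False using parity ev[OF ab(2,3)] by blast
    next
      case False
      then obtain x where x: "x \<in> L - {a, b}" using ab by blast
      then obtain i where i: "0 < i" "i < d" "odd i" "{f i, x} \<in> ?B"
        using attach[of x] True unfolding L'_def by auto
      have "{f i, x} \<in> B" using i(4) True by (auto elim!: minor_memberE)
      then have e: "(f i, x) \<in> pair_graph B ^^ 1" "(x, f i) \<in> pair_graph B ^^ 1"
        by (auto simp: pair_graph_def insert_commute)
      have "d \<le> i + 1" using least[OF _ ab(2) _ _ walk_trans[OF fa e(1)]] i x by auto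
      moreover have "d \<le> 1 + (d - i)"
        using least[OF _ _ ab(3) _ walk_trans[OF e(2) fb]] i x ab(1) by auto
      ultimately have d2: "d = 2" using i by linarith
      have "{f 1, a} \<in> B" "{f 1, b} \<in> B" "f 1 \<notin> L"
        using f(3)[of 0 1] f(3)[of 1 2] f(1,2) inner[of 1] d2
        by (auto simp: pair_graph_def insert_commute)
      then show False
        using delta_minor_of_common_neighbour[OF cl L _ ab(2,3,4)] free
        unfolding delta_hole_free_def by metis
    qed
  qed
qed

section \<open>Covers of at most half the weight\<close>

text \<open>
  Suppose some member contained at most one element outside the even side and none in the odd side.
  Contract that element, if there is one, and delete the rest of the complement of the component.
  The element is not adjacent to the component, so all members keep at least two elements and the
  walks in the component survive; but now some member lies inside the even side.
\<close>

lemma two_le_card_minor_of_sides: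
  assumes free: "delta_hole_free W B" and two: "\<And>M. M \<in> B \<Longrightarrow> 2 \<le> card M" and v: "v \<in> W"
    and N: "N \<in> minor B (odd_reach B v) (even_reach B v)"
  shows "2 \<le> card N"
proof (rule ccontr)
  assume small: "\<not> 2 \<le> card N"
  have cl: "clutter W B" using free unfolding delta_hole_free_def by blast
  define U where "U = even_reach B v"
  define U' where "U' = odd_reach B v"
  have UW: "U \<subseteq> W" "U' \<subseteq> W" unfolding U_def U'_def using reach_subset[OF cl v] .
  obtain A where A: "A \<in> B" "A \<inter> U' = {}" "N = A - U"
    using N unfolding U_def U'_def by (rule minor_memberE)
  have fN: "finite N" using clutter_finite_member[OF cl A(1)] A(3) by simp
  have N1: "x = y" if "x \<in> N" "y \<in> N" for x y
    using small two_le_card[OF fN that] by blast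
  define X where "X = N"
  define I where "I = W - (U \<union> U' \<union> X)"
  let ?B = "minor B I X"
  have XU: "X \<inter> (U \<union> U') = {}" using A unfolding X_def by blast
  have XW: "X \<subseteq> W" using A clutter_member_subset[OF cl A(1)] unfolding X_def by blast
  have two': "2 \<le> card M" if M: "M \<in> ?B" for M
  proof -
    obtain D where D: "D \<in> B" "D \<inter> I = {}" "M = D - X" using M by (rule minor_memberE)
    have fD: "finite D" using clutter_finite_member[OF cl D(1)] .
    show ?thesis
    proof (cases "D \<inter> X = {}")
      case True
      then show ?thesis using two[OF D(1)] D(3) by (simp add: Diff_triv)
    next
      case False
      then obtain x where x: "x \<in> D" "x \<in> X" by blast
      then have M': "M = D - {x}" using N1 D(3) unfolding X_def by blast
      have "D \<noteq> {x}" using two[OF D(1)] by auto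
      then obtain y where y: "y \<in> D" "y \<noteq> x" using x by blast
      have "y \<notin> X" using y x N1 unfolding X_def by blast
      then have yU: "y \<in> U \<union> U'"
        using y D(2) clutter_member_subset[OF cl D(1)] unfolding I_def by blast
      have "D \<noteq> {y, x}"
      proof
        assume "D = {y, x}"
        then have "x \<in> U \<union> U'" using yU reach_step[of y x B v] D(1) unfolding U_def U'_def by blast
        then show False using x XU by blast
      qed
      then obtain z where "z \<in> D" "z \<noteq> x" "z \<noteq> y" using x y by blast
      then show ?thesis using two_le_card[of M y z] fD y M' by simp
    qed
  qed
  have walk: "(v, y) \<in> pair_graph ?B ^^ n" if "(v, y) \<in> pair_graph B ^^ n" for y n
    using that
  proof (induction n arbitrary: y)
    case 0
    then show ?case by simp
  next
    case (Suc n)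
    then obtain z where z: "(v, z) \<in> pair_graph B ^^ n" "(z, y) \<in> pair_graph B" by auto
    then have e: "{z, y} \<in> B" unfolding pair_graph_def by simp
    have "z \<in> U \<union> U'"
      using even_reachI[OF _ z(1)] odd_reachI[OF _ z(1)] unfolding U_def U'_def by (cases "even n") auto
    moreover have "y \<in> U \<union> U'"
      using even_reachI[OF _ Suc.prems] odd_reachI[OF _ Suc.prems] unfolding U_def U'_def
      by (cases "even (Suc n)") auto
    ultimately have "{z, y} \<inter> I = {}" unfolding I_def by blast
    then have "{z, y} \<in> ?B" using pair_in_minor[OF cl e _ _ two', where x = z and y = y] by blast
    then have "(z, y) \<in> pair_graph ?B" unfolding pair_graph_def by simp
    then show ?case using Suc.IH[OF z(1)] by auto
  qed
  have sub: "I \<subseteq> W" "X \<subseteq> W" "I \<inter> X = {}" using XW unfolding I_def by blast+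
  have free': "delta_hole_free (W - (I \<union> X)) ?B" using delta_hole_free_minor[OF free sub] .
  have "A \<inter> I = {}" using A unfolding I_def X_def by blast
  then obtain L where L: "L \<in> ?B" "L \<subseteq> A - X"
    using minor_below[of A B I X] clutter_finite_member[OF cl A(1)] A(1) by blast
  have LU: "L \<subseteq> U" using L(2) A(3) unfolding X_def by blast
  have ev: "y \<in> even_reach ?B v" if "y \<in> L" for y
  proof -
    have "y \<in> even_reach B v" using that LU unfolding U_def by blast
    then obtain n where "even n" "(v, y) \<in> pair_graph B ^^ n" by (rule even_reachE)
    then show ?thesis using even_reachI[OF _ walk] by blast
  qed
  show False
    by (rule member_not_in_even_class[OF free' two' L(1)])
      (use even_even_reach even_reach_sym ev in metis)+
qed

lemma delta_hole_free_minor_of_sides: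
  assumes free: "delta_hole_free W B" and two: "\<And>M. M \<in> B \<Longrightarrow> 2 \<le> card M" and v: "v \<in> W"
  shows "delta_hole_free (W - (odd_reach B v \<union> even_reach B v)) (minor B (odd_reach B v) (even_reach B v))"
proof (rule delta_hole_free_minor[OF free])
  have cl: "clutter W B" using free unfolding delta_hole_free_def by blast
  show "odd_reach B v \<subseteq> W" "even_reach B v \<subseteq> W" using reach_subset[OF cl v] by simp_all
  show "odd_reach B v \<inter> even_reach B v = {}"
    using even_odd_reach_disjoint[OF free two, of _ v] by blast
qed

text \<open>
  A cover of the minor together with the odd side meets every member: a member that avoids the odd
  side contains a member of the minor outside the even side.
\<close>

lemma cover_union_odd_side:
  fixes w :: "'a \<Rightarrow> real"
  assumes free: "delta_hole_free W B" and two: "\<And>M. M \<in> B \<Longrightarrow> 2 \<le> card M" and v: "v \<in> W"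
    and A: "cover (W - (odd_reach B v \<union> even_reach B v)) (minor B (odd_reach B v) (even_reach B v)) A"
    and wA: "2 * sum w A \<le> sum w (W - (odd_reach B v \<union> even_reach B v))"
  shows "cover W B (A \<union> odd_reach B v)"
    and "2 * sum w (A \<union> odd_reach B v) \<le> sum w W - (sum w (even_reach B v) - sum w (odd_reach B v))"
proof -
  have cl: "clutter W B" using free unfolding delta_hole_free_def by blast
  then have fW: "finite W" unfolding clutter_def by blast
  define U where "U = even_reach B v"
  define U' where "U' = odd_reach B v"
  have UW: "U \<subseteq> W" "U' \<subseteq> W" unfolding U_def U'_def using reach_subset[OF cl v] .
  have fU: "finite U" "finite U'" using UW fW finite_subset by blast+
  have disj: "U \<inter> U' = {}"
    using even_odd_reach_disjoint[OF free two] unfolding U_def U'_def by blast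
  note A = A[folded U_def U'_def] and wA = wA[folded U_def U'_def]
  have AW: "A \<subseteq> W - (U' \<union> U)" using A unfolding cover_def by blast
  have fA: "finite A" using finite_subset[OF AW] fW by blast
  show "cover W B (A \<union> odd_reach B v)"
    unfolding U'_def[symmetric] cover_def
  proof (intro conjI ballI)
    show "A \<union> U' \<subseteq> W" using AW UW by blast
    fix M assume M: "M \<in> B"
    show "(A \<union> U') \<inter> M \<noteq> {}"
    proof (cases "M \<inter> U' = {}")
      case True
      obtain N where "N \<in> minor B U' U" "N \<subseteq> M - U"
        using minor_below[OF clutter_finite_member[OF cl M] M True] .
      then show ?thesis using A unfolding cover_def by blast
    qed blast
  qed
  have "sum w W = sum w (W - (U' \<union> U)) + sum w (U' \<union> U)"
    using UW fW by (intro sum.subset_diff) auto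
  moreover have "sum w (U' \<union> U) = sum w U' + sum w U"
    using fU disj by (intro sum.union_disjoint) auto
  moreover have "sum w (A \<union> U') = sum w A + sum w U'"
    using fA fU AW by (intro sum.union_disjoint) auto
  ultimately show "2 * sum w (A \<union> odd_reach B v) \<le> sum w W - (sum w (even_reach B v) - sum w (odd_reach B v))"
    using wA unfolding U_def[symmetric] U'_def[symmetric] by linarith
qed

text \<open>
  Contract the heavier side of a component, delete the lighter one, and add the lighter side to a cover
  of the minor. By linear programming duality this is the existence of a fractional packing
  of value two in the blocker of \<open>B\<close>.
\<close>

lemma half_weight_cover:
  fixes w :: "'a \<Rightarrow> real"
  assumes "delta_hole_free W B" "\<And>M. M \<in> B \<Longrightarrow> 2 \<le> card M" "\<And>x. x \<in> W \<Longrightarrow> 0 \<le> w x"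
  shows "\<exists>A. cover W B A \<and> 2 * sum w A \<le> sum w W"
  using assms
proof (induction "card W" arbitrary: W B rule: less_induct)
  case less
  note free = less.prems(1) and two = less.prems(2) and w = less.prems(3)
  have cl: "clutter W B" using free unfolding delta_hole_free_def by blast
  then have fW: "finite W" unfolding clutter_def by blast
  show ?case
  proof (cases "W = {}")
    case True
    have "M \<notin> B" for M
      using two[of M] clutter_member_subset[OF cl, of M] True by auto
    then have "cover W B {}" unfolding cover_def by blast
    then show ?thesis using True by auto
  next
    case False
    then obtain u where u: "u \<in> W" by blast
    have "\<exists>v\<in>W. sum w (odd_reach B v) \<le> sum w (even_reach B v)"
    proof (cases "sum w (odd_reach B u) \<le> sum w (even_reach B u)")
      case True
      then show ?thesis using u by blast
    next
      case False
      have "0 \<le> sum w (even_reach B u)"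
        using reach_subset(1)[OF cl u] w by (intro sum_nonneg) blast
      then have "odd_reach B u \<noteq> {}" using False by auto
      then obtain v where "v \<in> odd_reach B u" by blast
      then show ?thesis
        using reach_cong[of v B u] reach_subset(2)[OF cl u] False by (intro bexI[of _ v]) auto
    qed
    then obtain v where v: "v \<in> W" "sum w (odd_reach B v) \<le> sum w (even_reach B v)" by blast
    let ?W = "W - (odd_reach B v \<union> even_reach B v)"
    let ?B = "minor B (odd_reach B v) (even_reach B v)"
    have free': "delta_hole_free ?W ?B"
      using delta_hole_free_minor_of_sides[OF free two v(1)] .
    have smaller: "card ?W < card W"
      using v(1) even_reach_refl[of v B] fW by (intro psubset_card_mono) blast+
    have two': "2 \<le> card N" if "N \<in> ?B" for N
      using two_le_card_minor_of_sides[OF free two v(1) that] .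
    obtain A where "cover ?W ?B A" "2 * sum w A \<le> sum w ?W"
      using less.hyps[OF smaller free' two'] w by blast
    note A = cover_union_odd_side[OF free two v(1) this]
    have "2 * sum w (A \<union> odd_reach B v) \<le> sum w W" using A(2) v(2) by linarith
    then show ?thesis using A(1) by blast
  qed
qed

text \<open>
  Any component may be treated first, so a difference between its two sides is a strict gain.
\<close>

corollary less_half_weight_cover:
  fixes w :: "'a \<Rightarrow> real"
  assumes free: "delta_hole_free W B" and two: "\<And>M. M \<in> B \<Longrightarrow> 2 \<le> card M"
    and w: "\<And>x. x \<in> W \<Longrightarrow> 0 \<le> w x" and v: "v \<in> W" "sum w (odd_reach B v) < sum w (even_reach B v)"
  obtains A where "cover W B A" "2 * sum w A < sum w W"
proof -
  have cl: "clutter W B" using free unfolding delta_hole_free_def by blast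
  let ?W = "W - (odd_reach B v \<union> even_reach B v)"
  let ?B = "minor B (odd_reach B v) (even_reach B v)"
  have free': "delta_hole_free ?W ?B"
    using delta_hole_free_minor_of_sides[OF free two v(1)] .
  have two': "2 \<le> card N" if "N \<in> ?B" for N
    using two_le_card_minor_of_sides[OF free two v(1) that] .
  obtain A where "cover ?W ?B A" "2 * sum w A \<le> sum w ?W"
    using half_weight_cover[OF free' two', of w] w by blast
  note A = cover_union_odd_side[OF free two v(1) this]
  have "2 * sum w (A \<union> odd_reach B v) < sum w W" using A(2) v(2) by linarith
  then show thesis using that A(1) by blast
qed

section \<open>Members that split every minimum cover\<close>

definition splits_pairs :: "'a set set \<Rightarrow> 'a set \<Rightarrow> bool" where
  "splits_pairs B A \<longleftrightarrow> (\<forall>x y. {x, y} \<in> B \<longrightarrow> x \<in> A \<longrightarrow> y \<notin> A)"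

text \<open>
  Every cover of \<open>B\<close> meets each pair, so adding a large multiple \<open>N\<close> of the degree to the weight \<open>s\<close>
  makes every cover that contains a whole pair weigh more than half of the total. The degrees
  contribute equally to both sides of each component and so preserve the difference of the sides.
\<close>

lemma pair_splitting_cover:
  fixes s :: "'a \<Rightarrow> real"
  assumes free: "delta_hole_free W B" and two: "\<And>M. M \<in> B \<Longrightarrow> 2 \<le> card M"
    and edges: "\<And>x. x \<in> W \<Longrightarrow> \<exists>y. {x, y} \<in> B"
    and zero: "sum s W = 0" and v: "v \<in> W" "sum s (odd_reach B v) \<noteq> sum s (even_reach B v)"
  obtains A where "cover W B A" "splits_pairs B A" "sum s A < 0"
proof -
  have cl: "clutter W B" using free unfolding delta_hole_free_def by blast
  then have fW: "finite W" unfolding clutter_def by blast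
  obtain u where u: "u \<in> W" "sum s (odd_reach B u) < sum s (even_reach B u)"
  proof (cases "sum s (odd_reach B v) < sum s (even_reach B v)")
    case True
    then show ?thesis using that v by blast
  next
    case False
    obtain y where "{v, y} \<in> B" using edges v(1) by blast
    then have y: "y \<in> odd_reach B v" by (rule edge_odd_reach)
    then have "y \<in> W" using reach_subset(2)[OF cl v(1)] by blast
    then show ?thesis using that[of y] reach_cong[OF y] False v(2) by auto
  qed
  define E where "E = pair_graph B"
  have E_iff: "(x, y) \<in> E \<longleftrightarrow> {x, y} \<in> B" for x y unfolding E_def pair_graph_def by simp
  have EW: "E \<subseteq> W \<times> W" using clutter_member_subset[OF cl] E_iff by fast
  then have fE: "finite E" using fW finite_subset by blast
  define deg where "deg x = card (E `` {x})" for x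
  have fd: "finite (E `` {x})" for x using fE by (rule finite_Image)
  have deg_sum: "(\<Sum>x\<in>A. deg x) = card (Sigma A (\<lambda>x. E `` {x}))" if "finite A" for A
    unfolding deg_def using that fd by (simp add: card_SigmaI)
  have fU: "finite (even_reach B u)" "finite (odd_reach B u)"
    using reach_subset[OF cl u(1)] fW finite_subset by blast+
  have "Sigma (odd_reach B u) (\<lambda>x. E `` {x}) = prod.swap ` Sigma (even_reach B u) (\<lambda>x. E `` {x})"
  proof (intro equalityI subsetI)
    fix e assume "e \<in> Sigma (odd_reach B u) (\<lambda>x. E `` {x})"
    then obtain x y where e: "e = (x, y)" "x \<in> odd_reach B u" "{x, y} \<in> B" using E_iff by auto
    then have "y \<in> even_reach B u" using reach_step(1) by metis
    moreover have "(y, x) \<in> E" using e(3) E_iff by (simp add: insert_commute)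
    ultimately show "e \<in> prod.swap ` Sigma (even_reach B u) (\<lambda>x. E `` {x})"
      using e(1) by force
  next
    fix e assume "e \<in> prod.swap ` Sigma (even_reach B u) (\<lambda>x. E `` {x})"
    then obtain x y where e: "e = (y, x)" "x \<in> even_reach B u" "{x, y} \<in> B" using E_iff by auto
    then have "y \<in> odd_reach B u" using reach_step(2) by metis
    moreover have "(y, x) \<in> E" using e(3) E_iff by (simp add: insert_commute)
    ultimately show "e \<in> Sigma (odd_reach B u) (\<lambda>x. E `` {x})" using e(1) by simp
  qed
  then have balanced: "(\<Sum>x\<in>odd_reach B u. deg x) = (\<Sum>x\<in>even_reach B u. deg x)"
    unfolding deg_sum[OF fU(1)] deg_sum[OF fU(2)] by (simp add: card_image)
  \<comment> \<open>A pair inside a cover costs N, which is more than s can make up for, since its sums lie between -K and K.\<close>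
  define K where "K = (\<Sum>x\<in>W. \<bar>s x\<bar>)"
  define N where "N = 2 * K + 1"
  have K: "\<bar>sum s A\<bar> \<le> K" if "A \<subseteq> W" for A
  proof -
    have "\<bar>sum s A\<bar> \<le> (\<Sum>x\<in>A. \<bar>s x\<bar>)" by (rule sum_abs)
    also have "\<dots> \<le> K" unfolding K_def using that fW by (intro sum_mono2) auto
    finally show ?thesis .
  qed
  have K0: "0 \<le> K" unfolding K_def by (intro sum_nonneg) auto
  define w where "w x = N * real (deg x) + s x" for x
  have w_sum: "sum w A = N * real (\<Sum>x\<in>A. deg x) + sum s A" for A
    unfolding w_def by (simp add: sum.distrib sum_distrib_left)
  have w_nonneg: "0 \<le> w x" if x: "x \<in> W" for x
  proof -
    obtain y where "y \<in> E `` {x}" using edges[OF x] E_iff by blast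
    then have "1 \<le> deg x" unfolding deg_def using fd[of x] by (metis card_0_eq empty_iff less_one not_le)
    then have "N * 1 \<le> N * real (deg x)" using K0 unfolding N_def by (intro mult_left_mono) auto
    moreover have "\<bar>s x\<bar> \<le> K" using K[of "{x}"] x by simp
    ultimately show ?thesis using K0 N_def unfolding w_def by linarith
  qed
  have "sum w (odd_reach B u) < sum w (even_reach B u)" unfolding w_sum balanced using u(2) by simp
  then obtain A where A: "cover W B A" "2 * sum w A < sum w W"
    using less_half_weight_cover[OF free two, of w u] w_nonneg u(1) by blast
  have AW: "A \<subseteq> W" using A(1) unfolding cover_def by blast
  then have fA: "finite A" using fW finite_subset by blast
  \<comment> \<open>F consists of the ordered pairs that start in A; F and its converse overlap in the pairs inside A.\<close>
  define F where "F = Sigma A (\<lambda>x. E `` {x})"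
  have fF: "finite F" unfolding F_def using fA fd by blast
  have "Sigma W (\<lambda>x. E `` {x}) = F \<union> F\<inverse>"
  proof (intro equalityI subsetI)
    fix e assume "e \<in> Sigma W (\<lambda>x. E `` {x})"
    then obtain x y where e: "e = (x, y)" "{x, y} \<in> B" using E_iff by auto
    have "A \<inter> {x, y} \<noteq> {}" using A(1) e(2) unfolding cover_def by blast
    then have "x \<in> A \<or> y \<in> A" by blast
    moreover have "(x, y) \<in> E" "(y, x) \<in> E" using e(2) E_iff[of x y] E_iff[of y x] by (simp_all add: insert_commute)
    ultimately show "e \<in> F \<union> F\<inverse>" unfolding F_def e(1) by auto
  next
    fix e assume "e \<in> F \<union> F\<inverse>"
    then have "e \<in> E \<or> e \<in> E\<inverse>" unfolding F_def by auto
    moreover have "E\<inverse> = E" unfolding E_def using pair_graph_sym by fast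
    ultimately have "e \<in> E" by blast
    then show "e \<in> Sigma W (\<lambda>x. E `` {x})" using EW by auto
  qed
  then have "(\<Sum>x\<in>W. deg x) + card (F \<inter> F\<inverse>) = 2 * card F"
    using card_Un_Int[OF fF, of "F\<inverse>"] fF deg_sum[OF fW] by simp
  then have "real (\<Sum>x\<in>W. deg x) = 2 * real (\<Sum>x\<in>A. deg x) - real (card (F \<inter> F\<inverse>))"
    unfolding deg_sum[OF fA] F_def[symmetric] by linarith
  then have "N * real (\<Sum>x\<in>W. deg x)
      = 2 * (N * real (\<Sum>x\<in>A. deg x)) - N * real (card (F \<inter> F\<inverse>))"
    by (simp only: right_diff_distrib mult.left_commute)
  then have key: "N * real (card (F \<inter> F\<inverse>)) + 2 * sum s A < 0"
    using A(2) w_sum[of A] w_sum[of W] zero by linarith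
  have c0: "card (F \<inter> F\<inverse>) = 0"
  proof (rule ccontr)
    assume "card (F \<inter> F\<inverse>) \<noteq> 0"
    then have "1 \<le> real (card (F \<inter> F\<inverse>))" by linarith
    then have "N * 1 \<le> N * real (card (F \<inter> F\<inverse>))" using K0 N_def by (intro mult_left_mono) linarith+
    then show False using key K[OF AW] N_def by linarith
  qed
  then have none: "F \<inter> F\<inverse> = {}" using fF by simp
  have neg: "sum s A < 0" using key unfolding c0 by simp
  have "y \<notin> A" if "{x, y} \<in> B" "x \<in> A" for x y
  proof
    assume "y \<in> A"
    have "(x, y) \<in> E" "(y, x) \<in> E" using that(1) E_iff[of x y] E_iff[of y x] by (simp_all add: insert_commute)
    then have "(x, y) \<in> F \<inter> F\<inverse>" unfolding F_def using that(2) \<open>y \<in> A\<close> by auto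
    then show False using none by blast
  qed
  then have "splits_pairs B A" unfolding splits_pairs_def by blast
  with A(1) neg show thesis using that by blast
qed

lemma tangled_covers:
  assumes "clutter V C" "tangled V C"
  shows "M \<in> blocker V C \<Longrightarrow> 2 \<le> card M"
    and "{x, y} \<in> minimum_covers V C \<longleftrightarrow> {x, y} \<in> blocker V C"
    and "x \<in> V \<Longrightarrow> \<exists>y. {x, y} \<in> blocker V C"
proof -
  have tau: "covering_number V C = 2" using assms(2) unfolding tangled_def by blast
  have fV: "finite V" using assms(1) unfolding clutter_def by blast
  have two: "2 \<le> card M" if "cover V C M" for M
  proof -
    have "covering_number V C \<le> enat (card M)"
      unfolding covering_number_def using that by (intro INF_lower) simp
    then show ?thesis unfolding tau by (simp add: numeral_eq_enat)
  qed
  have min_iff: "M \<in> minimum_covers V C \<longleftrightarrow> cover V C M \<and> card M = 2" for M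
    unfolding minimum_covers_def tau by (auto simp: numeral_eq_enat)
  show "2 \<le> card M" if "M \<in> blocker V C" for M
    using two[OF blocker_member_cover[OF that]] .
  have min_blocker: "M \<in> blocker V C" if M: "M \<in> minimum_covers V C" for M
  proof -
    have c: "cover V C M" "card M = 2" using M min_iff by blast+
    have "\<not> X \<subset> M" if "cover V C X" for X
    proof
      assume "X \<subset> M"
      then have "card X < card M" using c(2) by (intro psubset_card_mono) (auto intro: card_ge_0_finite)
      then show False using two[OF that] c(2) by simp
    qed
    then show ?thesis using c(1) unfolding blocker_def minimal_sets_def by blast
  qed
  show "{x, y} \<in> minimum_covers V C \<longleftrightarrow> {x, y} \<in> blocker V C" for x y
  proof
    assume "{x, y} \<in> blocker V C"
    then have "cover V C {x, y}" by (rule blocker_member_cover)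
    moreover have "card {x, y} = 2" using two[OF calculation] by (cases "x = y") auto
    ultimately show "{x, y} \<in> minimum_covers V C" using min_iff by blast
  qed (rule min_blocker)
  show "\<exists>y. {x, y} \<in> blocker V C" if "x \<in> V" for x
  proof -
    have "\<exists>B\<in>minimum_covers V C. x \<in> B" using assms(2) that unfolding tangled_def by simp
    then obtain M where M: "M \<in> minimum_covers V C" "x \<in> M" by blast
    have "card M = 2" using M(1) min_iff by blast
    then obtain a b where "M = {a, b}" by (auto simp: card_2_iff)
    with M have "M = {x, a} \<or> M = {x, b}" by auto
    then show ?thesis using min_blocker[OF M(1)] by metis
  qed
qed

text \<open>
  The cover contains a member \<open>D\<close>. Each \<open>x \<in> A\<close> belongs to a pair \<open>{x, y}\<close>, which \<open>D\<close> has to meet,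
  and it can only do so in \<open>x\<close>.
\<close>

lemma splitting_cover_member:
  assumes C: "clutter V C" and A: "cover V (blocker V C) A"
    and split: "splits_pairs (blocker V C) A"
    and edges: "\<And>x. x \<in> V \<Longrightarrow> \<exists>y. {x, y} \<in> blocker V C"
  shows "A \<in> C"
proof -
  have "finite V" using C unfolding clutter_def by blast
  then obtain D where "D \<in> blocker V (blocker V C)" "D \<subseteq> A"
    using cover_above_blocker_member[OF _ A] by blast
  then have D: "D \<in> C" "D \<subseteq> A" unfolding blocker_blocker[OF C] .
  have "A \<subseteq> D"
  proof
    fix x assume x: "x \<in> A"
    then obtain y where y: "{x, y} \<in> blocker V C" using edges A unfolding cover_def by blast
    have "{x, y} \<inter> D \<noteq> {}" using blocker_member_cover[OF y] D(1) unfolding cover_def by blast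
    then show "x \<in> D" using split y x D(2) unfolding splits_pairs_def by blast
  qed
  then show ?thesis using D by (simp add: subset_antisym)
qed

lemma component_eq_sides: "(pair_graph B)\<^sup>* `` {v} = even_reach B v \<union> odd_reach B v"
proof (intro equalityI subsetI)
  fix x assume "x \<in> (pair_graph B)\<^sup>* `` {v}"
  then obtain n where n: "(v, x) \<in> pair_graph B ^^ n" using rtrancl_imp_relpow by blast
  show "x \<in> even_reach B v \<union> odd_reach B v"
    using even_reachI[OF _ n] odd_reachI[OF _ n] by blast
next
  fix x assume "x \<in> even_reach B v \<union> odd_reach B v"
  then have "\<exists>n. (v, x) \<in> pair_graph B ^^ n" by (auto elim: even_reachE odd_reachE)
  then show "x \<in> (pair_graph B)\<^sup>* `` {v}" using relpow_imp_rtrancl by blast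
qed

text \<open>
  The labels are the elements of the ground set of a cuboid: the index of the component, and
  the side of the bipartition relative to a chosen root.
\<close>

lemma component_labelling:
  assumes free: "delta_hole_free V B" and two: "\<And>M. M \<in> B \<Longrightarrow> 2 \<le> card M"
    and card: "card (V // (pair_graph B)\<^sup>*) = CARD('n::finite)"
  obtains root :: "'n::finite \<Rightarrow> 'a" and label :: "'a \<Rightarrow> 'n \<times> bool" where
    "\<And>i. root i \<in> V"
    "\<And>v i. v \<in> V \<Longrightarrow> label v = (i, True) \<longleftrightarrow> v \<in> even_reach B (root i)"
    "\<And>v i. v \<in> V \<Longrightarrow> label v = (i, False) \<longleftrightarrow> v \<in> odd_reach B (root i)"
proof -
  have cl: "clutter V B" using free unfolding delta_hole_free_def by blast
  then have fV: "finite V" unfolding clutter_def by blast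
  let ?R = "(pair_graph B)\<^sup>*"
  have "finite (V // ?R)" unfolding quotient_def using fV by simp
  then obtain c where c: "bij_betw c (UNIV :: 'n::finite set) (V // ?R)"
    using finite_same_card_bij[OF finite_class.finite_UNIV] card by metis
  have "\<exists>v. v \<in> V \<and> c i = even_reach B v \<union> odd_reach B v" for i
  proof -
    have "c i \<in> V // ?R" using c by (auto simp: bij_betw_def)
    then show ?thesis by (elim quotientE) (auto simp: component_eq_sides)
  qed
  then obtain root where root: "\<And>i. root i \<in> V" "\<And>i. c i = even_reach B (root i) \<union> odd_reach B (root i)"
    by metis
  have ex: "\<exists>i. v \<in> c i" if v: "v \<in> V" for v
  proof -
    have "even_reach B v \<union> odd_reach B v \<in> V // ?R"
      using quotientI[OF v, of ?R] unfolding component_eq_sides .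
    then obtain i where "c i = even_reach B v \<union> odd_reach B v"
      using c unfolding bij_betw_def by (metis imageE)
    then show ?thesis using even_reach_refl[of v B] by blast
  qed
  have eqc: "c i = even_reach B v \<union> odd_reach B v" if v: "v \<in> c i" for v i
  proof -
    consider "v \<in> even_reach B (root i)" | "v \<in> odd_reach B (root i)" using v root(2) by blast
    then show ?thesis
    proof cases
      case 1
      note vr = even_reach_sym[OF 1]
      have "even_reach B v = even_reach B (root i)"
        by (intro equalityI subsetI, erule even_even_reach[OF 1], erule even_even_reach[OF vr])
      moreover have "odd_reach B v = odd_reach B (root i)"
        by (intro equalityI subsetI, erule even_odd_reach[OF 1], erule even_odd_reach[OF vr])
      ultimately show ?thesis unfolding root(2) by simp
    next
      case 2
      then show ?thesis unfolding root(2) reach_cong[OF 2] by blast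
    qed
  qed
  have uniq: "i = j" if "v \<in> c i" "v \<in> c j" for v i j
    using eqc[OF that(1)] eqc[OF that(2)] c unfolding bij_betw_def by (metis injD)
  define idx where "idx v = (THE i. v \<in> c i)" for v
  have idx: "idx v = i \<longleftrightarrow> v \<in> c i" if "v \<in> V" for v i
    unfolding idx_def using theI'[of "\<lambda>i. v \<in> c i"] ex[OF that] uniq by metis
  define label where "label v = (idx v, v \<in> even_reach B (root (idx v)))" for v
  have lab: "label v = (i, True) \<longleftrightarrow> idx v = i \<and> v \<in> even_reach B (root i)"
    "label v = (i, False) \<longleftrightarrow> idx v = i \<and> v \<notin> even_reach B (root i)" for v i
    unfolding label_def by auto
  show thesis
  proof (rule that[OF root(1)])
    fix v i assume v: "v \<in> V"
    note disj = even_odd_reach_disjoint[OF free two, of v "root i"]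
    show "label v = (i, True) \<longleftrightarrow> v \<in> even_reach B (root i)"
      unfolding lab idx[OF v] root(2) by blast
    show "label v = (i, False) \<longleftrightarrow> v \<in> odd_reach B (root i)"
      unfolding lab idx[OF v] root(2) using disj by blast
  qed
qed

section \<open>Duplications as pullbacks along a labelling\<close>

lemma duplicates_to_imp_pullback:
  assumes "duplicates_to W D V C" "D \<subseteq> Pow W"
  shows "\<exists>f. f ` V = W \<and> C = (\<lambda>A. {v \<in> V. f v \<in> A}) ` D"
  using assms
proof (induction rule: duplicates_to.induct)
  case refl
  have "{v \<in> W. id v \<in> A} = A" if "A \<in> D" for A using that refl by auto
  then have "D = (\<lambda>A. {v \<in> W. id v \<in> A}) ` D" by simp
  moreover have "id ` W = W" by simp
  ultimately show ?case by blast
next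
  case (step V C w w')
  then obtain f where f: "f ` V = W" "C = (\<lambda>A. {v \<in> V. f v \<in> A}) ` D" by blast
  define f' where "f' = f(w' := f w)"
  have same: "f' v = f v" if "v \<in> V" for v using that step.hyps(3) unfolding f'_def by auto
  have new: "f' w' = f w" unfolding f'_def by simp
  have "f' ` V = f ` V" using same by (intro image_cong) simp_all
  then have "f' ` insert w' V = W" using f(1) step.hyps(2) new by auto
  moreover have "(if w \<in> {v \<in> V. f v \<in> A} then insert w' {v \<in> V. f v \<in> A} else {v \<in> V. f v \<in> A})
      = {v \<in> insert w' V. f' v \<in> A}" for A
  proof -
    have "{v \<in> insert w' V. f' v \<in> A} = (if f w \<in> A then {w'} else {}) \<union> {v \<in> V. f' v \<in> A}"
      using new by auto
    moreover have "{v \<in> V. f' v \<in> A} = {v \<in> V. f v \<in> A}" using same by (intro Collect_cong) auto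
    ultimately show ?thesis using step.hyps(2) by simp
  qed
  then have "duplicate w w' C = (\<lambda>A. {v \<in> insert w' V. f' v \<in> A}) ` D"
    unfolding duplicate_def f(2) image_image by simp
  ultimately show ?case by blast
qed

text \<open>
  All that a duplication records is of which original element each element is a copy.
\<close>

lemma duplication_of_iff_pullback:
  assumes "finite V" "D \<subseteq> Pow W"
  shows "duplication_of V C W D \<longleftrightarrow> (\<exists>f. f ` V = W \<and> C = (\<lambda>A. {v \<in> V. f v \<in> A}) ` D)"
proof
  assume "duplication_of V C W D"
  then obtain g where g: "inj_on g W" "duplicates_to (g ` W) ((`) g ` D) V C"
    unfolding duplication_of_def by blast
  have "(`) g ` D \<subseteq> Pow (g ` W)" using assms(2) by auto
  then obtain f where f: "f ` V = g ` W" "C = (\<lambda>A. {v \<in> V. f v \<in> A}) ` (`) g ` D"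
    using duplicates_to_imp_pullback[OF g(2)] by blast
  let ?h = "\<lambda>v. inv_into W g (f v)"
  have "?h ` V = inv_into W g ` g ` W" using f(1) by (metis image_image)
  then have "?h ` V = W" using g(1) by simp
  moreover have "{v \<in> V. f v \<in> g ` A} = {v \<in> V. ?h v \<in> A}" if A: "A \<in> D" for A
  proof -
    have "f v \<in> g ` A \<longleftrightarrow> ?h v \<in> A" if "v \<in> V" for v
    proof -
      have "f v \<in> g ` W" using that unfolding f(1)[symmetric] by (rule imageI)
      then obtain x where x: "x \<in> W" "f v = g x" by (elim imageE)
      then have "?h v = x" using g(1) by simp
      moreover have "A \<subseteq> W" using A assms(2) by blast
      ultimately show ?thesis using x inj_on_image_mem_iff[OF g(1) x(1)] by simp
    qed
    then show ?thesis by blast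
  qed
  then have "C = (\<lambda>A. {v \<in> V. ?h v \<in> A}) ` D" unfolding f(2) image_image by simp
  ultimately show "\<exists>f. f ` V = W \<and> C = (\<lambda>A. {v \<in> V. f v \<in> A}) ` D" by blast
next
  assume "\<exists>f. f ` V = W \<and> C = (\<lambda>A. {v \<in> V. f v \<in> A}) ` D"
  then obtain f where f: "f ` V = W" "C = (\<lambda>A. {v \<in> V. f v \<in> A}) ` D" by blast
  define g where "g = inv_into V f"
  have gV: "g x \<in> V" and fg: "f (g x) = x" if "x \<in> W" for x
    using that f(1) unfolding g_def by (auto intro: inv_into_into f_inv_into_f)
  have inj: "inj_on g W" using fg by (metis inj_onI)
  define T where "T = g ` W"
  have base: "{v \<in> T. f v \<in> A} = g ` A" if "A \<in> D" for A
    using that assms(2) fg unfolding T_def by fastforce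
  have all: "duplicates_to T ((`) g ` D) (T \<union> X) ((\<lambda>A. {v \<in> T \<union> X. f v \<in> A}) ` D)"
    if "X \<subseteq> V - T" for X
    using finite_subset[OF that finite_Diff[OF assms(1)]] that
  proof (induction X rule: finite_induct)
    case empty
    have "(\<lambda>A. {v \<in> T \<union> {}. f v \<in> A}) ` D = (`) g ` D" using base by simp
    then show ?case using duplicates_to.refl[of T] by simp
  next
    case (insert x X)
    have fx: "f x \<in> W" using insert.prems f(1) by blast
    let ?w = "g (f x)"
    have "?w \<in> T \<union> X" "x \<notin> T \<union> X" using fx insert unfolding T_def by auto
    then have "duplicates_to T ((`) g ` D) (insert x (T \<union> X))
        (duplicate ?w x ((\<lambda>A. {v \<in> T \<union> X. f v \<in> A}) ` D))"
      using insert by (intro duplicates_to.step) auto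
    moreover have "(if ?w \<in> {v \<in> T \<union> X. f v \<in> A} then insert x {v \<in> T \<union> X. f v \<in> A} else {v \<in> T \<union> X. f v \<in> A})
        = {v \<in> insert x (T \<union> X). f v \<in> A}" for A
      using \<open>?w \<in> T \<union> X\<close> fg[OF fx] by auto
    then have "duplicate ?w x ((\<lambda>A. {v \<in> T \<union> X. f v \<in> A}) ` D)
        = (\<lambda>A. {v \<in> insert x (T \<union> X). f v \<in> A}) ` D"
      unfolding duplicate_def image_image by simp
    ultimately show ?case by simp
  qed
  have TV: "T \<union> (V - T) = V" using gV unfolding T_def by blast
  have "duplicates_to T ((`) g ` D) V C"
    using all[of "V - T", OF order_refl] unfolding TV f(2) .
  then show "duplication_of V C W D" unfolding duplication_of_def T_def using inj by blast
qed

lemma cuboid_member_iff: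
  "(i, True) \<in> cuboid_member p \<longleftrightarrow> p $ i = 1" "(i, False) \<in> cuboid_member p \<longleftrightarrow> p $ i = 0"
  unfolding cuboid_member_def by auto

lemma cuboid_member_flip:
  assumes "p \<in> zero_one_points"
  shows "(i, \<not> b) \<in> cuboid_member p \<longleftrightarrow> (i, b) \<notin> cuboid_member p"
proof -
  have "p $ i = 0 \<or> p $ i = 1" using assms unfolding zero_one_points_def by simp
  then show ?thesis using cuboid_member_iff[of i p] by (cases b) auto
qed

text \<open>
  Two labellings with the same pullback differ by a bijection of the labels: two elements with
  the same second label lie in the same members, and the first labels are separated by members.
  For the same reason the bijection commutes with complementation, hence is a permutation
  of the coordinates followed by a twist.
\<close>

lemma isomorphic_sets_of_equal_pullbacks:
  fixes f f' :: "'a \<Rightarrow> 'n::finite \<times> bool"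
  assumes S: "S \<subseteq> zero_one_points" "S' \<subseteq> zero_one_points"
    and surj: "f ` V = UNIV" "f' ` V = UNIV"
    and eq: "(\<lambda>A. {v \<in> V. f v \<in> A}) ` cuboid S = (\<lambda>A. {v \<in> V. f' v \<in> A}) ` cuboid S'"
    and sep: "\<And>x y. (\<And>p. p \<in> S \<Longrightarrow> x \<in> cuboid_member p \<longleftrightarrow> y \<in> cuboid_member p) \<Longrightarrow> x = y"
  shows "isomorphic_sets S S'"
proof -
  let ?m = "\<lambda>p. {v \<in> V. f v \<in> cuboid_member p}" and ?m' = "\<lambda>q. {v \<in> V. f' v \<in> cuboid_member q}"
  have ex': "\<exists>q\<in>S'. ?m p = ?m' q" if "p \<in> S" for p
  proof -
    have "?m p \<in> (\<lambda>A. {v \<in> V. f v \<in> A}) ` cuboid S" unfolding cuboid_def using that by blast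
    then show ?thesis unfolding eq unfolding cuboid_def by auto
  qed
  have ex: "\<exists>p\<in>S. ?m p = ?m' q" if "q \<in> S'" for q
  proof -
    have "?m' q \<in> (\<lambda>A. {v \<in> V. f' v \<in> A}) ` cuboid S'" unfolding cuboid_def using that by blast
    then show ?thesis unfolding eq[symmetric] unfolding cuboid_def by auto
  qed
  define g where "g x = f (inv_into V f' x)" for x
  have rep: "inv_into V f' x \<in> V" "f' (inv_into V f' x) = x" for x
    using surj(2) by (auto intro: inv_into_into f_inv_into_f)
  have g: "f v = g (f' v)" if v: "v \<in> V" for v
  proof (rule sep)
    fix p assume "p \<in> S"
    then obtain q where q: "?m p = ?m' q" using ex' by blast
    let ?u = "inv_into V f' (f' v)"
    have "f v \<in> cuboid_member p \<longleftrightarrow> v \<in> ?m' q" using v q by blast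
    also have "\<dots> \<longleftrightarrow> ?u \<in> ?m' q" using v rep[of "f' v"] by simp
    also have "\<dots> \<longleftrightarrow> g (f' v) \<in> cuboid_member p" using rep(1)[of "f' v"] unfolding q[symmetric] g_def by simp
    finally show "f v \<in> cuboid_member p \<longleftrightarrow> g (f' v) \<in> cuboid_member p" .
  qed
  have transfer: "x \<in> cuboid_member q \<longleftrightarrow> g x \<in> cuboid_member p" if "?m p = ?m' q" for p q x
  proof -
    obtain v where v: "v \<in> V" "f' v = x" using rep by blast
    have "v \<in> ?m p \<longleftrightarrow> v \<in> ?m' q" using that by simp
    then show ?thesis using v g[OF v(1)] by simp
  qed
  have "y \<in> range g" for y
  proof -
    obtain v where "v \<in> V" "f v = y" using surj(1) by (metis UNIV_I imageE)
    then show ?thesis using g by blast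
  qed
  then have "surj g" by blast
  then have inj: "inj g" by (simp add: finite_UNIV_surj_inj)
  have flip: "g (i, \<not> b) = (fst (g (i, b)), \<not> snd (g (i, b)))" for i b
  proof (rule sep)
    fix p assume p: "p \<in> S"
    then obtain q where q: "q \<in> S'" "?m p = ?m' q" using ex' by blast
    have 01: "p \<in> zero_one_points" "q \<in> zero_one_points" using p q S by blast+
    show "g (i, \<not> b) \<in> cuboid_member p \<longleftrightarrow> (fst (g (i, b)), \<not> snd (g (i, b))) \<in> cuboid_member p"
      unfolding transfer[OF q(2), symmetric] cuboid_member_flip[OF 01(2)] cuboid_member_flip[OF 01(1)]
      using transfer[OF q(2), of "(i, b)"] by simp
  qed
  define \<pi> where "\<pi> i = fst (g (i, True))" for i
  define T where "T = {i. \<not> snd (g (i, True))}"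
  have gT: "g (i, True) = (\<pi> i, i \<notin> T)" for i unfolding \<pi>_def T_def by (simp add: prod_eq_iff)
  have "inj \<pi>"
  proof (rule injI)
    fix i j assume ij: "\<pi> i = \<pi> j"
    show "i = j"
    proof (cases "i \<in> T \<longleftrightarrow> j \<in> T")
      case True
      then have "g (i, True) = g (j, True)" using ij gT by simp
      then show ?thesis using inj by (simp add: inj_eq)
    next
      case False
      then have "g (i, True) = g (j, \<not> True)" unfolding flip[of j True] gT using ij by auto
      then show ?thesis using inj by (simp add: inj_eq)
    qed
  qed
  then have bij: "bij \<pi>" by (simp add: bij_def finite_UNIV_inj_surj)
  have coord: "q = twist_coords T (relabel_coords \<pi> p)" if pq: "p \<in> S" "q \<in> S'" "?m p = ?m' q" for p q
  proof (rule vec_eq_iff[THEN iffD2, rule_format])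
    fix i
    have "q $ i = 1 \<longleftrightarrow> (\<pi> i, i \<notin> T) \<in> cuboid_member p"
      using transfer[OF pq(3), of "(i, True)"] unfolding gT cuboid_member_iff .
    then have "q $ i = 1 \<longleftrightarrow> (if i \<in> T then p $ \<pi> i = 0 else p $ \<pi> i = 1)"
      using cuboid_member_iff[of "\<pi> i" p] by auto
    moreover have "q $ i = 0 \<or> q $ i = 1" "p $ \<pi> i = 0 \<or> p $ \<pi> i = 1"
      using pq S unfolding zero_one_points_def by blast+
    ultimately show "q $ i = twist_coords T (relabel_coords \<pi> p) $ i"
      unfolding twist_coords_def relabel_coords_def by (auto split: if_splits)
  qed
  have "S' = twist_coords T ` relabel_coords \<pi> ` S"
  proof (intro equalityI subsetI)
    fix q assume "q \<in> S'"
    then show "q \<in> twist_coords T ` relabel_coords \<pi> ` S" using ex coord by blast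
  next
    fix q assume "q \<in> twist_coords T ` relabel_coords \<pi> ` S"
    then obtain p where "p \<in> S" "q = twist_coords T (relabel_coords \<pi> p)" by blast
    then show "q \<in> S'" using ex' coord by blast
  qed
  then show ?thesis unfolding isomorphic_sets_def using bij by blast
qed

section \<open>Convex hulls of finite sets around a point\<close>

lemma point_in_interior_convex_hull:
  fixes c :: "'a::euclidean_space"
  assumes "finite S" "\<And>u. u \<noteq> 0 \<Longrightarrow> \<exists>p\<in>S. u \<bullet> p < u \<bullet> c"
  shows "c \<in> interior (convex hull S)"
proof (rule ccontr)
  let ?T = "convex hull S"
  assume no: "c \<notin> interior ?T"
  show False
  proof (cases "interior ?T = {}")
    case True
    have "aff_dim ?T \<noteq> int DIM('a)"
    proof
      assume full: "aff_dim ?T = int DIM('a)"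
      then have "?T \<noteq> {}" by (metis aff_dim_empty_eq of_nat_0_le_iff not_le neg_less_0_iff_less zero_less_one)
      then have "rel_interior ?T \<noteq> {}" by (simp add: rel_interior_eq_empty)
      then show False using True full by (simp add: interior_rel_interior_gen)
    qed
    then have "aff_dim ?T < int DIM('a)" using aff_dim_le_DIM[of ?T] by linarith
    then obtain a b where ab: "a \<noteq> 0" "?T \<subseteq> {x. a \<bullet> x = b}" by (rule aff_lowdim_subset_hyperplane)
    have "\<exists>p\<in>S. a \<bullet> p < a \<bullet> c" by (rule assms(2)[OF ab(1)])
    moreover have "\<exists>p\<in>S. (- a) \<bullet> p < (- a) \<bullet> c" by (rule assms(2)) (use ab(1) in simp)
    moreover have "a \<bullet> p = b" if "p \<in> S" for p using hull_subset[of S convex] that ab(2) by blast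
    ultimately show False by auto
  next
    case False
    have "convex (interior ?T)" by (simp add: convex_interior)
    then obtain a b where ab: "a \<noteq> 0" "\<forall>x\<in>{c}. a \<bullet> x \<le> b" "\<forall>x\<in>interior ?T. b \<le> a \<bullet> x"
      using separating_hyperplane_sets[of "{c}" "interior ?T"] no False by auto
    have "?T \<subseteq> closure (interior ?T)"
      using convex_closure_interior[OF convex_convex_hull False] closure_subset by metis
    also have "\<dots> \<subseteq> {x. b \<le> a \<bullet> x}"
      using ab(3) by (intro closure_minimal closed_halfspace_ge) auto
    finally have "b \<le> a \<bullet> p" if "p \<in> S" for p using hull_subset[of S convex] that by blast
    moreover obtain p where "p \<in> S" "a \<bullet> p < a \<bullet> c" using assms(2)[OF ab(1)] by blast
    ultimately show False using ab(2) by fastforce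
  qed
qed

text \<open>
  Move from \<open>c\<close> a little away from \<open>p\<close>, staying in the hull, and come back by adding a multiple of \<open>p\<close>.
\<close>

lemma interior_convex_hull_positive_coefficient:
  fixes c :: "'a::euclidean_space"
  assumes fin: "finite S" and c: "c \<in> interior (convex hull S)" and p: "p \<in> S"
  obtains \<alpha> where "\<And>x. x \<in> S \<Longrightarrow> 0 \<le> \<alpha> x" "sum \<alpha> S = 1" "(\<Sum>x\<in>S. \<alpha> x *\<^sub>R x) = c" "0 < \<alpha> p"
proof -
  obtain e where e: "0 < e" "ball c e \<subseteq> convex hull S" using c unfolding mem_interior by blast
  define t where "t = e / (2 * (norm (c - p) + 1))"
  have pos: "0 < norm (c - p) + 1" by (simp add: add_nonneg_pos)
  have t0: "0 < t" unfolding t_def using e(1) pos by simp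
  have "t * norm (c - p) \<le> t * (norm (c - p) + 1)" using t0 by (intro mult_left_mono) auto
  also have "\<dots> = e / 2" unfolding t_def using pos by (simp add: field_simps)
  also have "\<dots> < e" using e(1) by simp
  finally have "dist c (c + t *\<^sub>R (c - p)) < e" using t0 by (simp add: dist_norm)
  then have "c + t *\<^sub>R (c - p) \<in> convex hull S" using e(2) by auto
  then obtain u where u: "\<forall>x\<in>S. 0 \<le> u x" "sum u S = 1" "(\<Sum>x\<in>S. u x *\<^sub>R x) = c + t *\<^sub>R (c - p)"
    unfolding convex_hull_finite[OF fin] by blast
  define \<alpha> where "\<alpha> x = (u x + (if x = p then t else 0)) / (1 + t)" for x
  have nonneg: "0 \<le> \<alpha> x" if "x \<in> S" for x unfolding \<alpha>_def using u(1) that t0 by simp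
  have "sum \<alpha> S = (sum u S + (\<Sum>x\<in>S. if x = p then t else 0)) / (1 + t)"
    unfolding \<alpha>_def by (simp add: sum_divide_distrib[symmetric] sum.distrib)
  then have one: "sum \<alpha> S = 1" using u(2) fin p t0 by simp
  have "(\<Sum>x\<in>S. \<alpha> x *\<^sub>R x) = (1 / (1 + t)) *\<^sub>R ((\<Sum>x\<in>S. u x *\<^sub>R x) + (\<Sum>x\<in>S. if x = p then t *\<^sub>R p else 0))"
    unfolding \<alpha>_def scaleR_sum_right sum.distrib[symmetric]
    by (intro sum.cong) (auto simp: scaleR_add_left[symmetric])
  also have "\<dots> = (1 / (1 + t)) *\<^sub>R (c + t *\<^sub>R (c - p) + t *\<^sub>R p)"
    using u(3) fin p by simp
  also have "c + t *\<^sub>R (c - p) + t *\<^sub>R p = (1 + t) *\<^sub>R c" by (simp add: algebra_simps)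
  finally have point: "(\<Sum>x\<in>S. \<alpha> x *\<^sub>R x) = c" using t0 by simp
  have "0 < \<alpha> p" unfolding \<alpha>_def using u(1) p t0 by (simp add: add_nonneg_pos)
  with nonneg one point show thesis using that by blast
qed

section \<open>Packings of value two\<close>

text \<open>
  The loads of \<open>x\<close> and \<open>y\<close> are at most one each. Every member meets \<open>{x, y}\<close>, so the loads add up to
  at least the value two, and a member of positive weight containing both would make the sum larger.
\<close>

lemma packing_member_splits_pair:
  assumes C: "clutter V C" and e: "{x, y} \<in> blocker V C"
    and w: "w \<in> packings_of_value_two V C" and A: "A \<in> C" "0 < w A" "x \<in> A"
  shows "y \<notin> A"
proof
  assume y: "y \<in> A"
  have fC: "finite C" using C unfolding clutter_def by (meson finite_Pow_iff finite_subset)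
  have cov: "cover V C {x, y}" using blocker_member_cover[OF e] .
  then have xyV: "x \<in> V" "y \<in> V" unfolding cover_def by blast+
  have w_nonneg: "0 \<le> w D" if "D \<in> C" for D
    using w that unfolding packings_of_value_two_def fractional_packing_def by auto
  have le: "(\<Sum>D\<in>C. w D * of_bool (v \<in> D)) \<le> 1" if "v \<in> V" for v
  proof -
    have "(\<Sum>D\<in>C. w D * of_bool (v \<in> D)) = (\<Sum>D\<in>{D \<in> C. v \<in> D}. w D)"
      using fC by (simp add: of_bool_def if_distrib sum.inter_filter cong: if_cong)
    then show ?thesis using w that unfolding packings_of_value_two_def fractional_packing_def by auto
  qed
  define t where "t D = w D * (of_bool (x \<in> D) + of_bool (y \<in> D) - 1)" for D
  have t_nonneg: "0 \<le> t D" if D: "D \<in> C" for D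
  proof -
    have "{x, y} \<inter> D \<noteq> {}" using cov D unfolding cover_def by blast
    then have "x \<in> D \<or> y \<in> D" by blast
    then have "(0::real) \<le> of_bool (x \<in> D) + of_bool (y \<in> D) - 1" by auto
    then show ?thesis unfolding t_def using w_nonneg[OF D] by (intro mult_nonneg_nonneg)
  qed
  have total: "(\<Sum>D\<in>C. w D) = 2" using w unfolding packings_of_value_two_def by blast
  have "(\<Sum>D\<in>C. t D) = (\<Sum>D\<in>C. w D * of_bool (x \<in> D)) + (\<Sum>D\<in>C. w D * of_bool (y \<in> D)) - (\<Sum>D\<in>C. w D)"
    unfolding t_def by (simp add: algebra_simps sum.distrib sum_subtractf)
  then have "(\<Sum>D\<in>C. t D) \<le> 0" using le[OF xyV(1)] le[OF xyV(2)] total by linarith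
  moreover have "t A \<le> (\<Sum>D\<in>C. t D)" using fC A(1) t_nonneg by (intro member_le_sum) auto
  moreover have "t A = w A" unfolding t_def using y A(3) by simp
  ultimately show False using A(2) by linarith
qed

lemma sum_supported_on_image:
  fixes w :: "'b \<Rightarrow> real"
  assumes "finite C" "\<phi> ` S \<subseteq> C" "inj_on \<phi> S" "\<And>A. A \<in> C \<Longrightarrow> A \<notin> \<phi> ` S \<Longrightarrow> w A = 0"
  shows "(\<Sum>A\<in>{A \<in> C. P A}. w A) = (\<Sum>p\<in>S. w (\<phi> p) * of_bool (P (\<phi> p)))"
proof -
  have "(\<Sum>A\<in>{A \<in> C. P A}. w A) = (\<Sum>A\<in>C. w A * of_bool (P A))"
    using assms(1) by (simp add: of_bool_def if_distrib sum.inter_filter cong: if_cong)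
  also have "\<dots> = (\<Sum>A\<in>\<phi> ` S. w A * of_bool (P A))"
    using assms by (intro sum.mono_neutral_right) auto
  also have "\<dots> = (\<Sum>p\<in>S. w (\<phi> p) * of_bool (P (\<phi> p)))"
    using assms(3) by (simp add: sum.reindex)
  finally show ?thesis .
qed

lemma cuboid_member_indicator:
  fixes p :: "real ^ 'n"
  assumes "p \<in> zero_one_points"
  shows "of_bool ((i, True) \<in> cuboid_member p) = p $ i"
    and "of_bool ((i, False) \<in> cuboid_member p) = 1 - p $ i"
proof -
  have "p $ i = 0 \<or> p $ i = 1" using assms unfolding zero_one_points_def by simp
  then show "of_bool ((i, True) \<in> cuboid_member p) = p $ i"
    "of_bool ((i, False) \<in> cuboid_member p) = 1 - p $ i"
    unfolding cuboid_member_iff by auto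
qed

text \<open>
  The two sides of a component carry together the whole value two of a packing whose support
  splits them, so each carries exactly one. Halving turns this into barycentric coordinates
  of the centre of the cube.
\<close>

lemma packing_iff_convex_expression:
  fixes S :: "(real ^ 'n) set"
  assumes fC: "finite C" and S: "S \<subseteq> zero_one_points" and surj: "label ` V = UNIV"
    and \<phi>: "\<And>p. \<phi> p = {v \<in> V. label v \<in> cuboid_member p}" "\<phi> ` S \<subseteq> C" "inj_on \<phi> S"
    and w: "w \<in> C \<rightarrow>\<^sub>E {0..}" "\<And>A. A \<in> C \<Longrightarrow> A \<notin> \<phi> ` S \<Longrightarrow> w A = 0"
  shows "w \<in> packings_of_value_two V C \<longleftrightarrow> (\<lambda>p\<in>S. w (\<phi> p) / 2) \<in> convex_expressions S (vec (1/2))"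
proof -
  note sum_C = sum_supported_on_image[OF fC \<phi>(2,3) w(2)]
  have total: "(\<Sum>A\<in>C. w A) = (\<Sum>p\<in>S. w (\<phi> p))"
    using sum_C[where P = "\<lambda>_. True"] by simp
  have at: "(\<Sum>A\<in>{A \<in> C. v \<in> A}. w A) = (\<Sum>p\<in>S. w (\<phi> p) * of_bool (label v \<in> cuboid_member p))"
    if "v \<in> V" for v
    using sum_C[where P = "\<lambda>A. v \<in> A"] that unfolding \<phi>(1) by simp
  have at_True: "(\<Sum>A\<in>{A \<in> C. v \<in> A}. w A) = (\<Sum>p\<in>S. w (\<phi> p) * p $ i)"
    if "v \<in> V" "label v = (i, True)" for v i
    unfolding at[OF that(1)] that(2)
    by (intro sum.cong HOL.refl) (simp only: cuboid_member_indicator[OF subsetD[OF S]])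
  have at_False: "(\<Sum>A\<in>{A \<in> C. v \<in> A}. w A) = (\<Sum>A\<in>C. w A) - (\<Sum>p\<in>S. w (\<phi> p) * p $ i)"
    if "v \<in> V" "label v = (i, False)" for v i
  proof -
    have "(\<Sum>A\<in>{A \<in> C. v \<in> A}. w A) = (\<Sum>p\<in>S. w (\<phi> p) * (1 - p $ i))"
      unfolding at[OF that(1)] that(2)
      by (intro sum.cong HOL.refl) (simp only: cuboid_member_indicator[OF subsetD[OF S]])
    then show ?thesis unfolding total by (simp add: right_diff_distrib sum_subtractf)
  qed
  have nonneg: "0 \<le> w (\<phi> p)" if "p \<in> S" for p
  proof -
    have "\<phi> p \<in> C" using \<phi>(2) that by (simp add: image_subset_iff)
    then show ?thesis using PiE_mem[OF w(1)] by simp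
  qed
  have expr: "(\<lambda>p\<in>S. w (\<phi> p) / 2) \<in> convex_expressions S (vec (1/2)) \<longleftrightarrow>
      (\<Sum>p\<in>S. w (\<phi> p)) = 2 \<and> (\<forall>i. (\<Sum>p\<in>S. w (\<phi> p) * p $ i) = 1)"
  proof -
    have sum1: "(\<Sum>p\<in>S. (\<lambda>p\<in>S. w (\<phi> p) / 2) p) = (\<Sum>p\<in>S. w (\<phi> p)) / 2"
      by (simp add: sum_divide_distrib)
    have sum2: "(\<Sum>p\<in>S. (\<lambda>p\<in>S. w (\<phi> p) / 2) p *\<^sub>R p) $ i = (\<Sum>p\<in>S. w (\<phi> p) * p $ i) / 2" for i
      by (simp add: sum_divide_distrib)
    have "(\<lambda>p\<in>S. w (\<phi> p) / 2) \<in> S \<rightarrow>\<^sub>E {0..}" using nonneg by simp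
    then show ?thesis
      unfolding convex_expressions_def mem_Collect_eq vec_eq_iff sum1 sum2 by simp
  qed
  have lab: "\<exists>v\<in>V. label v = l" for l using surj by (metis UNIV_I imageE)
  show ?thesis
  proof
    assume "w \<in> packings_of_value_two V C"
    then have two: "(\<Sum>A\<in>C. w A) = 2" and le: "\<And>v. v \<in> V \<Longrightarrow> (\<Sum>A\<in>{A \<in> C. v \<in> A}. w A) \<le> 1"
      unfolding packings_of_value_two_def fractional_packing_def by simp_all
    have "(\<Sum>p\<in>S. w (\<phi> p) * p $ i) = 1" for i
    proof -
      obtain u where "u \<in> V" "label u = (i, True)" using lab by blast
      moreover obtain v where "v \<in> V" "label v = (i, False)" using lab by blast
      ultimately show ?thesis
        using le[of u] le[of v] at_True[of u i] at_False[of v i] two by linarith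
    qed
    then show "(\<lambda>p\<in>S. w (\<phi> p) / 2) \<in> convex_expressions S (vec (1/2))" using expr two total by simp
  next
    assume "(\<lambda>p\<in>S. w (\<phi> p) / 2) \<in> convex_expressions S (vec (1/2))"
    then have two: "(\<Sum>A\<in>C. w A) = 2" and one: "\<And>i. (\<Sum>p\<in>S. w (\<phi> p) * p $ i) = 1"
      using expr total by auto
    have "(\<Sum>A\<in>{A \<in> C. v \<in> A}. w A) \<le> 1" if v: "v \<in> V" for v
    proof -
      obtain i b where "label v = (i, b)" by fastforce
      then show ?thesis using at_True[OF v] at_False[OF v] one two by (cases b) auto
    qed
    then show "w \<in> packings_of_value_two V C"
      unfolding packings_of_value_two_def fractional_packing_def using w(1) two by blast
  qed
qed

lemma packings_bij_convex_expressions: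
  fixes S :: "(real ^ 'n) set"
  assumes fC: "finite C" and S: "S \<subseteq> zero_one_points" and surj: "label ` V = UNIV"
    and \<phi>: "\<And>p. \<phi> p = {v \<in> V. label v \<in> cuboid_member p}" "\<phi> ` S \<subseteq> C" "inj_on \<phi> S"
    and supp: "\<And>w A. w \<in> packings_of_value_two V C \<Longrightarrow> A \<in> C \<Longrightarrow> 0 < w A \<Longrightarrow> A \<in> \<phi> ` S"
  shows "bij_betw (\<lambda>w. \<lambda>p\<in>S. w (\<phi> p) / 2) (packings_of_value_two V C) (convex_expressions S (vec (1/2)))"
proof -
  let ?f = "\<lambda>w. \<lambda>p\<in>S. w (\<phi> p) / 2"
  let ?g = "\<lambda>\<alpha>. \<lambda>A\<in>C. if A \<in> \<phi> ` S then 2 * \<alpha> (inv_into S \<phi> A) else 0"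
  note iff = packing_iff_convex_expression[OF fC S surj \<phi>]
  have ext: "w \<in> C \<rightarrow>\<^sub>E {0..}" and zero: "\<And>A. A \<in> C \<Longrightarrow> A \<notin> \<phi> ` S \<Longrightarrow> w A = 0"
    if w: "w \<in> packings_of_value_two V C" for w
  proof -
    show e: "w \<in> C \<rightarrow>\<^sub>E {0..}"
      using w unfolding packings_of_value_two_def fractional_packing_def by blast
    show "w A = 0" if "A \<in> C" "A \<notin> \<phi> ` S" for A
    proof -
      have "0 \<le> w A" using e that(1) by auto
      then show ?thesis using supp[OF w that(1)] that(2) by fastforce
    qed
  qed
  have g_at: "?g \<alpha> (\<phi> p) = 2 * \<alpha> p" if "p \<in> S" for \<alpha> p
    using that \<phi>(2,3) by auto
  have fg: "?f (?g \<alpha>) = \<alpha>" if \<alpha>: "\<alpha> \<in> convex_expressions S (vec (1/2))" for \<alpha>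
  proof
    fix p
    show "?f (?g \<alpha>) p = \<alpha> p"
    proof (cases "p \<in> S")
      case True
      then show ?thesis using g_at[OF True, of \<alpha>] by simp
    next
      case False
      have "\<alpha> \<in> S \<rightarrow>\<^sub>E {0..}" using \<alpha> unfolding convex_expressions_def by simp
      then have "\<alpha> p = undefined" using False by (rule PiE_arb)
      then show ?thesis using False by simp
    qed
  qed
  show ?thesis
  proof (rule bij_betw_byWitness[where f' = ?g])
    show "\<forall>w\<in>packings_of_value_two V C. ?g (?f w) = w"
    proof (intro ballI HOL.ext)
      fix w A assume w: "w \<in> packings_of_value_two V C"
      show "?g (?f w) A = w A"
      proof (cases "A \<in> C")
        case True
        show ?thesis
        proof (cases "A \<in> \<phi> ` S")
          case image: True
          have "inv_into S \<phi> A \<in> S" "\<phi> (inv_into S \<phi> A) = A"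
            using inv_into_into[OF image] f_inv_into_f[OF image] .
          then show ?thesis using True image by simp
        next
          case False
          then show ?thesis using True zero[OF w True] by simp
        qed
      next
        case False
        then show ?thesis using PiE_arb[OF ext[OF w] False] by simp
      qed
    qed
    show "\<forall>\<alpha>\<in>convex_expressions S (vec (1/2)). ?f (?g \<alpha>) = \<alpha>" using fg by blast
    show "?f ` packings_of_value_two V C \<subseteq> convex_expressions S (vec (1/2))"
    proof (rule image_subsetI)
      fix w assume w: "w \<in> packings_of_value_two V C"
      show "?f w \<in> convex_expressions S (vec (1/2))" using iff[OF ext[OF w] zero[OF w]] w by blast
    qed
    show "?g ` convex_expressions S (vec (1/2)) \<subseteq> packings_of_value_two V C"
    proof
      fix w assume "w \<in> ?g ` convex_expressions S (vec (1/2))"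
      then obtain \<alpha> where \<alpha>: "\<alpha> \<in> convex_expressions S (vec (1/2))" "w = ?g \<alpha>" by blast
      have "\<alpha> \<in> S \<rightarrow>\<^sub>E {0..}" using \<alpha>(1) unfolding convex_expressions_def by simp
      then have \<alpha>_nonneg: "\<alpha> p \<in> {0..}" if "p \<in> S" for p using that by (rule PiE_mem)
      have "w \<in> C \<rightarrow>\<^sub>E {0..}"
        unfolding \<alpha>(2) restrict_PiE_iff
      proof
        fix A assume "A \<in> C"
        show "(if A \<in> \<phi> ` S then 2 * \<alpha> (inv_into S \<phi> A) else 0) \<in> {0..}"
          using \<alpha>_nonneg[OF inv_into_into[of A \<phi> S]] by simp
      qed
      moreover have "w A = 0" if "A \<in> C" "A \<notin> \<phi> ` S" for A unfolding \<alpha>(2) using that by simp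
      ultimately show "w \<in> packings_of_value_two V C"
        using iff[of w] fg[OF \<alpha>(1)] \<alpha>(1) unfolding \<alpha>(2)[symmetric] by simp
    qed
  qed
qed

section \<open>The structure of the core\<close>

text \<open>
  Along a walk of pairs, membership changes at every step.
\<close>

lemma splitting_cover_alternates:
  assumes A: "cover V B A" and split: "splits_pairs B A"
  shows "x \<in> even_reach B v \<Longrightarrow> x \<in> A \<longleftrightarrow> v \<in> A"
    and "x \<in> odd_reach B v \<Longrightarrow> x \<in> A \<longleftrightarrow> v \<notin> A"
proof -
  have walk: "x \<in> A \<longleftrightarrow> (if even n then v \<in> A else v \<notin> A)" if "(v, x) \<in> pair_graph B ^^ n" for x n
    using that
  proof (induction n arbitrary: x)
    case 0
    then show ?case by simp
  next
    case (Suc n)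
    then obtain z where z: "(v, z) \<in> pair_graph B ^^ n" "(z, x) \<in> pair_graph B" by auto
    then have e: "{z, x} \<in> B" unfolding pair_graph_def by simp
    have "A \<inter> {z, x} \<noteq> {}" using A e unfolding cover_def by blast
    then have "x \<in> A \<longleftrightarrow> z \<notin> A" using split e unfolding splits_pairs_def by blast
    then show ?case using Suc.IH[OF z(1)] by simp
  qed
  show "x \<in> A \<longleftrightarrow> v \<in> A" if "x \<in> even_reach B v"
    using that by (rule even_reachE) (simp add: walk)
  show "x \<in> A \<longleftrightarrow> v \<notin> A" if "x \<in> odd_reach B v"
    using that by (rule odd_reachE) (simp add: walk)
qed

text \<open>
  Two coordinates that agree on all of \<open>S\<close>, or disagree on all of \<open>S\<close>, confine \<open>S\<close> to a hyperplane through the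
  centre of the cube.
\<close>

lemma labels_separated:
  fixes S :: "(real ^ 'n::finite) set"
  assumes S: "S \<subseteq> zero_one_points" and below: "\<And>u. u \<noteq> 0 \<Longrightarrow> \<exists>p\<in>S. u \<bullet> p < u \<bullet> vec (1/2)"
    and same: "\<And>p. p \<in> S \<Longrightarrow> x \<in> cuboid_member p \<longleftrightarrow> y \<in> cuboid_member p"
  shows "x = y"
proof -
  obtain i b j c where xy: "x = (i, b)" "y = (j, c)" by fastforce
  define \<sigma> :: "bool \<Rightarrow> real" where "\<sigma> b = (if b then 1 else - 1)" for b
  have ij: "i = j"
  proof (rule ccontr)
    assume "i \<noteq> j"
    define u :: "real ^ 'n" where "u = axis i (\<sigma> b) - axis j (\<sigma> c)"
    have u: "u \<bullet> z = \<sigma> b * z $ i - \<sigma> c * z $ j" for z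
      unfolding u_def by (simp add: inner_diff_left inner_axis')
    have "u $ i \<noteq> 0" unfolding u_def \<sigma>_def using \<open>i \<noteq> j\<close> by (simp add: axis_def)
    then have "u \<noteq> 0" by auto
    then obtain p where p: "p \<in> S" "u \<bullet> p < u \<bullet> vec (1/2)" using below by blast
    have "p $ i = 0 \<or> p $ i = 1" "p $ j = 0 \<or> p $ j = 1"
      using p(1) S unfolding zero_one_points_def by blast+
    then show False
      using p(2) same[OF p(1)] cuboid_member_iff[of i p] cuboid_member_iff[of j p]
      unfolding u \<sigma>_def xy by (cases b; cases c) auto
  qed
  have "axis i (1 :: real) \<noteq> 0" by (simp add: axis_eq_0_iff)
  then obtain p where p: "p \<in> S" using below by blast
  have "b = c"
  proof (rule ccontr)
    assume "b \<noteq> c"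
    then have "c = (\<not> b)" by blast
    then show False using same[OF p] cuboid_member_flip[of p i b] p S unfolding xy ij by blast
  qed
  with ij xy show ?thesis by simp
qed

lemma splitting_cover_is_cuboid_pullback:
  fixes root :: "'n::finite \<Rightarrow> 'a"
  assumes A: "cover V B A" and split: "splits_pairs B A"
    and lab: "\<And>v i. v \<in> V \<Longrightarrow> label v = (i, True) \<longleftrightarrow> v \<in> even_reach B (root i)"
      "\<And>v i. v \<in> V \<Longrightarrow> label v = (i, False) \<longleftrightarrow> v \<in> odd_reach B (root i)"
  obtains p :: "real ^ 'n" where "p \<in> zero_one_points" "A = {v \<in> V. label v \<in> cuboid_member p}"
proof
  let ?p = "(\<chi> i. of_bool (root i \<in> A)) :: real ^ 'n"
  show "?p \<in> zero_one_points" unfolding zero_one_points_def by simp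
  have "v \<in> A \<longleftrightarrow> label v \<in> cuboid_member ?p" if v: "v \<in> V" for v
  proof -
    obtain i b where l: "label v = (i, b)" by fastforce
    show ?thesis
    proof (cases b)
      case True
      then have "v \<in> even_reach B (root i)" using l by (intro iffD1[OF lab(1)[OF v]]) simp
      then have "v \<in> A \<longleftrightarrow> root i \<in> A" by (rule splitting_cover_alternates(1)[OF A split])
      then show ?thesis using l True cuboid_member_iff(1)[of i ?p] by simp
    next
      case False
      then have "v \<in> odd_reach B (root i)" using l by (intro iffD1[OF lab(2)[OF v]]) simp
      then have "v \<in> A \<longleftrightarrow> root i \<notin> A" by (rule splitting_cover_alternates(2)[OF A split])
      then show ?thesis using l False cuboid_member_iff(2)[of i ?p] by simp
    qed
  qed
  then show "A = {v \<in> V. label v \<in> cuboid_member ?p}" using A unfolding cover_def by blast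
qed

lemma cuboid_member_inj:
  fixes p q :: "real ^ 'n"
  assumes "p \<in> zero_one_points" "q \<in> zero_one_points" "cuboid_member p = cuboid_member q"
  shows "p = q"
proof (rule vec_eq_iff[THEN iffD2, rule_format])
  fix i
  show "p $ i = q $ i"
    using cuboid_member_indicator(1)[OF assms(1), of i] cuboid_member_indicator(1)[OF assms(2), of i]
    unfolding assms(3) by simp
qed

text \<open>
  The direction \<open>u\<close> is turned into a weight on the ground set by putting \<open>u\<^sub>i\<close> on a root of the
  \<open>i\<close>-th component and \<open>- u\<^sub>i\<close> on a neighbour of the root.
\<close>

lemma cuboid_point_below_centre:
  fixes u :: "real ^ 'n" and root :: "'n \<Rightarrow> 'a"
  assumes C: "clutter V C" and free: "delta_hole_free V (blocker V C)"
    and two: "\<And>M. M \<in> blocker V C \<Longrightarrow> 2 \<le> card M"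
    and edges: "\<And>x. x \<in> V \<Longrightarrow> \<exists>y. {x, y} \<in> blocker V C"
    and root: "\<And>i. root i \<in> V"
    and lab: "\<And>v i. v \<in> V \<Longrightarrow> label v = (i, True) \<longleftrightarrow> v \<in> even_reach (blocker V C) (root i)"
      "\<And>v i. v \<in> V \<Longrightarrow> label v = (i, False) \<longleftrightarrow> v \<in> odd_reach (blocker V C) (root i)"
    and u: "u \<noteq> 0"
  obtains p where "p \<in> zero_one_points" "{v \<in> V. label v \<in> cuboid_member p} \<in> C" "u \<bullet> p < u \<bullet> vec (1/2)"
proof -
  let ?B = "blocker V C"
  have fV: "finite V" using C unfolding clutter_def by blast
  have clB: "clutter V ?B" using free unfolding delta_hole_free_def by blast
  have "\<exists>y. y \<in> V \<and> label y = (i, False)" for i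
  proof -
    obtain y where y: "{root i, y} \<in> ?B" using edges[OF root] by blast
    then have "y \<in> V" using clutter_member_subset[OF clB] by blast
    then show ?thesis using iffD2[OF lab(2) edge_odd_reach[OF y]] by blast
  qed
  then obtain mate where mate: "\<And>i. mate i \<in> V" "\<And>i. label (mate i) = (i, False)" by metis
  have lroot: "label (root i) = (i, True)" for i
    by (rule iffD2[OF lab(1)[OF root] even_reach_refl])
  \<comment> \<open>Summing s over a cover that splits the pairs gives twice u \<bullet> (p - vec (1/2)).\<close>
  define s where "s x = (\<Sum>i\<in>UNIV. u $ i * (of_bool (x = root i) - of_bool (x = mate i)))" for x
  have s_sum: "sum s A = (\<Sum>i\<in>UNIV. u $ i * (of_bool (root i \<in> A) - of_bool (mate i \<in> A)))"
    if "finite A" for A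
  proof -
    have one: "(\<Sum>x\<in>A. of_bool (x = r)) = (of_bool (r \<in> A) :: real)" for r
      using that by (simp add: of_bool_def)
    have "sum s A = (\<Sum>i\<in>UNIV. \<Sum>x\<in>A. u $ i * (of_bool (x = root i) - of_bool (x = mate i)))"
      unfolding s_def by (rule sum.swap)
    also have "\<dots> = (\<Sum>i\<in>UNIV. u $ i * ((\<Sum>x\<in>A. of_bool (x = root i)) - (\<Sum>x\<in>A. of_bool (x = mate i))))"
      unfolding sum_distrib_left[symmetric] sum_subtractf ..
    finally show ?thesis unfolding one .
  qed
  have zero: "sum s V = 0" unfolding s_sum[OF fV] using root mate(1) by simp
  obtain j where j: "u $ j \<noteq> 0" using u by (auto simp: vec_eq_iff)
  have sub: "even_reach ?B (root j) \<subseteq> V" "odd_reach ?B (root j) \<subseteq> V"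
    using reach_subset[OF clB root] by blast+
  have mem: "root i \<in> even_reach ?B (root j) \<longleftrightarrow> i = j" "mate i \<notin> even_reach ?B (root j)"
    "root i \<notin> odd_reach ?B (root j)" "mate i \<in> odd_reach ?B (root j) \<longleftrightarrow> i = j" for i
    unfolding lab(1)[OF root, symmetric] lab(2)[OF root, symmetric]
      lab(1)[OF mate(1), symmetric] lab(2)[OF mate(1), symmetric] lroot mate(2) by simp_all
  have "sum s (even_reach ?B (root j)) = (\<Sum>i\<in>UNIV. if i = j then u $ j else 0)"
    unfolding s_sum[OF finite_subset[OF sub(1) fV]] by (intro sum.cong) (simp_all add: mem)
  moreover have "sum s (odd_reach ?B (root j)) = (\<Sum>i\<in>UNIV. if i = j then - u $ j else 0)"
    unfolding s_sum[OF finite_subset[OF sub(2) fV]] by (intro sum.cong) (simp_all add: mem)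
  ultimately have "sum s (odd_reach ?B (root j)) \<noteq> sum s (even_reach ?B (root j))"
    using j by simp
  then obtain A where A: "cover V ?B A" "splits_pairs ?B A" "sum s A < 0"
    using pair_splitting_cover[OF free two edges zero root[of j]] by blast
  have AC: "A \<in> C" using splitting_cover_member[OF C A(1,2) edges] .
  obtain p :: "real ^ 'n" where p: "p \<in> zero_one_points" "A = {v \<in> V. label v \<in> cuboid_member p}"
    using splitting_cover_is_cuboid_pullback[OF A(1,2) lab] .
  have "of_bool (root i \<in> A) - of_bool (mate i \<in> A) = 2 * p $ i - 1" for i
  proof -
    have "root i \<in> A \<longleftrightarrow> (i, True) \<in> cuboid_member p" "mate i \<in> A \<longleftrightarrow> (i, False) \<in> cuboid_member p"
      unfolding p(2) using root mate lroot by simp_all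
    then show ?thesis using cuboid_member_indicator[OF p(1), of i] by simp
  qed
  then have "sum s A = (\<Sum>i\<in>UNIV. u $ i * (2 * p $ i - 1))"
    using s_sum[of A] finite_subset[of A V] A(1) fV unfolding cover_def by simp
  also have "\<dots> = 2 * (u \<bullet> p - u \<bullet> vec (1/2))"
    unfolding inner_vec_def by (simp add: sum_distrib_left sum_subtractf algebra_simps)
  finally have "u \<bullet> p < u \<bullet> vec (1/2)" using A(3) by simp
  then show thesis using that p AC by blast
qed

theorem theorem1p5:
  fixes V :: "'a set" and C :: "'a set set"
  assumes "clutter V C" and "clean V C" and "tangled V C"
    and "clutter_rank V C = CARD('n::finite)"
  shows "\<exists>S :: (real ^ 'n) set. S \<subseteq> zero_one_points \<and>
     (duplication_of V (core V C) UNIV (cuboid S) \<and>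
      (\<forall>S' :: (real ^ 'n) set. S' \<subseteq> zero_one_points \<and>
         duplication_of V (core V C) UNIV (cuboid S') \<longrightarrow> isomorphic_sets S S')) \<and>
     (\<exists>\<phi>. bij_betw \<phi> S (core V C) \<and>
        bij_betw (\<lambda>y. \<lambda>p\<in>S. y (\<phi> p) / 2)
          (packings_of_value_two V C) (convex_expressions S (vec (1/2)))) \<and>
     (polytope (convex hull S) \<and> aff_dim (convex hull S) = int CARD('n) \<and>
      vec (1/2) \<in> interior (convex hull S))"
proof -
  note C = assms(1)
  let ?B = "blocker V C"
  have free: "delta_hole_free V ?B" using clean_imp_blocker_delta_hole_free[OF C assms(2)] .
  note two = tangled_covers(1)[OF C assms(3)] and edges = tangled_covers(3)[OF C assms(3)]
  have fV: "finite V" using C unfolding clutter_def by blast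
  have fC: "finite C" using C unfolding clutter_def by (meson finite_Pow_iff finite_subset)
  have "pair_graph ?B = {(u, v). {u, v} \<in> minimum_covers V C}"
    unfolding pair_graph_def tangled_covers(2)[OF C assms(3)] ..
  then have "card (V // (pair_graph ?B)\<^sup>*) = CARD('n)"
    using assms(4) unfolding clutter_rank_def connected_components_of_graph_def by simp
  then obtain root :: "'n \<Rightarrow> 'a" and label :: "'a \<Rightarrow> 'n \<times> bool" where
    root: "\<And>i. root i \<in> V" and
    lab: "\<And>v i. v \<in> V \<Longrightarrow> label v = (i, True) \<longleftrightarrow> v \<in> even_reach ?B (root i)"
      "\<And>v i. v \<in> V \<Longrightarrow> label v = (i, False) \<longleftrightarrow> v \<in> odd_reach ?B (root i)"
    using component_labelling[OF free two] by metis
  have surj: "label ` V = UNIV"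
  proof -
    have "l \<in> label ` V" for l
    proof -
      obtain i b where l: "l = (i, b)" by fastforce
      obtain y where y: "{root i, y} \<in> ?B" using edges[OF root] by blast
      then have yV: "y \<in> V" using clutter_member_subset[OF clutter_blocker[OF fV]] by blast
      have "label (root i) = (i, True)" by (rule iffD2[OF lab(1)[OF root] even_reach_refl])
      moreover have "label y = (i, False)" by (rule iffD2[OF lab(2)[OF yV] edge_odd_reach[OF y]])
      ultimately show ?thesis using root[of i] yV unfolding l by (cases b) (metis imageI)+
    qed
    then show ?thesis by blast
  qed
  define \<phi> where "\<phi> p = {v \<in> V. label v \<in> cuboid_member p}" for p :: "real ^ 'n"
  define S where "S = {p \<in> zero_one_points. \<phi> p \<in> C}"
  have S01: "S \<subseteq> zero_one_points" and \<phi>C: "\<phi> ` S \<subseteq> C" unfolding S_def by blast+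
  have "inj_on \<phi> S"
  proof (rule inj_onI)
    fix p q assume pq: "p \<in> S" "q \<in> S" "\<phi> p = \<phi> q"
    have image: "label ` {v \<in> V. label v \<in> X} = X \<inter> label ` V" for X by auto
    have "label ` \<phi> p = cuboid_member p" "label ` \<phi> q = cuboid_member q"
      unfolding \<phi>_def image surj by simp_all
    then have "cuboid_member p = cuboid_member q" using pq(3) by simp
    then show "p = q" using cuboid_member_inj subsetD[OF S01] pq(1,2) by blast
  qed
  note inj = this
  then have fS: "finite S" using inj_on_finite[OF _ \<phi>C fC] by blast
  have below: "\<exists>p\<in>S. u \<bullet> p < u \<bullet> vec (1/2)" if u: "u \<noteq> 0" for u :: "real ^ 'n"
  proof -
    obtain p where "p \<in> zero_one_points" "{v \<in> V. label v \<in> cuboid_member p} \<in> C" "u \<bullet> p < u \<bullet> vec (1/2)"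
      using cuboid_point_below_centre[OF C free two edges root lab u] .
    then show ?thesis unfolding S_def \<phi>_def by blast
  qed
  have centre: "vec (1/2) \<in> interior (convex hull S)"
    using point_in_interior_convex_hull[OF fS below] .
  \<comment> \<open>Packings of value two are supported on the image of S; that every point of S occurs follows from the position of the centre.\<close>
  have supp: "A \<in> \<phi> ` S" if w: "w \<in> packings_of_value_two V C" and A: "A \<in> C" "0 < w A" for w A
  proof -
    have cov: "cover V ?B A"
      unfolding cover_def
    proof (intro conjI ballI)
      show "A \<subseteq> V" using clutter_member_subset[OF C A(1)] .
      fix M assume "M \<in> ?B"
      then have "cover V C M" by (rule blocker_member_cover)
      then show "A \<inter> M \<noteq> {}" using A(1) unfolding cover_def by blast
    qed
    have "splits_pairs ?B A"
      unfolding splits_pairs_def using packing_member_splits_pair[OF C _ w A] by blast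
    then obtain p :: "real ^ 'n" where "p \<in> zero_one_points" "A = {v \<in> V. label v \<in> cuboid_member p}"
      using splitting_cover_is_cuboid_pullback[OF cov _ lab] by blast
    then show ?thesis using A(1) unfolding S_def \<phi>_def by blast
  qed
  have bij: "bij_betw (\<lambda>y. \<lambda>p\<in>S. y (\<phi> p) / 2) (packings_of_value_two V C) (convex_expressions S (vec (1/2)))"
    using packings_bij_convex_expressions[OF fC S01 surj \<phi>_def \<phi>C inj supp] .
  have core: "core V C = \<phi> ` S"
  proof (intro equalityI subsetI)
    fix A assume "A \<in> core V C"
    then show "A \<in> \<phi> ` S" unfolding core_def using supp by blast
  next
    fix A assume "A \<in> \<phi> ` S"
    then obtain p where p: "p \<in> S" "A = \<phi> p" by blast
    obtain \<alpha> where \<alpha>: "\<And>x. x \<in> S \<Longrightarrow> 0 \<le> \<alpha> x" "sum \<alpha> S = 1" "(\<Sum>x\<in>S. \<alpha> x *\<^sub>R x) = vec (1/2)" "0 < \<alpha> p"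
      using interior_convex_hull_positive_coefficient[OF fS centre p(1)] by blast
    then have "restrict \<alpha> S \<in> convex_expressions S (vec (1/2))"
      unfolding convex_expressions_def by simp
    then obtain y where y: "y \<in> packings_of_value_two V C" "restrict \<alpha> S = (\<lambda>p\<in>S. y (\<phi> p) / 2)"
      using bij unfolding bij_betw_def by blast
    have "\<alpha> p = y (\<phi> p) / 2" using fun_cong[OF y(2), of p] p(1) by simp
    then have "0 < y A" using \<alpha>(4) p(2) by simp
    then show "A \<in> core V C" unfolding core_def using y(1) p \<phi>C by blast
  qed
  have core': "core V C = (\<lambda>A. {v \<in> V. label v \<in> A}) ` cuboid S"
    unfolding core cuboid_def image_image \<phi>_def ..
  have cub: "cuboid S' \<subseteq> Pow UNIV" for S' :: "(real ^ 'n) set" by simp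
  have dup: "duplication_of V (core V C) UNIV (cuboid S)"
    unfolding duplication_of_iff_pullback[OF fV cub]
    using surj core' by blast
  have unique: "isomorphic_sets S S'"
    if S': "S' \<subseteq> zero_one_points" "duplication_of V (core V C) UNIV (cuboid S')" for S' :: "(real ^ 'n) set"
  proof -
    obtain f where f: "f ` V = UNIV" "core V C = (\<lambda>A. {v \<in> V. f v \<in> A}) ` cuboid S'"
      using S'(2) unfolding duplication_of_iff_pullback[OF fV cub]
      by blast
    show ?thesis
      using isomorphic_sets_of_equal_pullbacks[OF S01 S'(1) surj f(1) _ labels_separated[OF S01 below]]
        core' f(2) by metis
  qed
  have "aff_dim (convex hull S) = int CARD('n)"
    using aff_dim_nonempty_interior[of "convex hull S"] centre by auto
  then show ?thesis
    using S01 dup unique inj core bij centre polytope_convex_hull[OF fS]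
    by (intro exI[of _ S]) (auto simp: bij_betw_def intro!: exI[of _ \<phi>])
qed

end
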